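(* Let $\Omega\subset\mathbb{R}^2$ be a bounded polygonal domain, let $0<\alpha_0\le\alpha_1$ and $b_0>0$ be constants, and let $b:\mathbb{R}\to\mathbb{R}$ be continuous, $b\in W^{2,\infty}(\mathbb{R})$, with $b(t)\ge b_0$ for all $t\in\mathbb{R}$. Then there exist constants $\delta>0$ and $C>0$, independent of $\epsilon$ and $h$, such that the following holds. Let $\alpha_\epsilon:\Omega\to\mathbb{R}$ be measurable with $\alpha_0\le\alpha_\epsilon(x)\le\alpha_1$ for almost every $x\in\Omega$, let $f\in L^2(\Omega)$, let $V_r=V_h\oplus V_b$ be the residual-free bubble space associated with a partition $\mathcal{T}_h$ of $\Omega$, let $u_\epsilon\in H^1_0(\Omega)$ satisfy $$\int_\Omega\alpha_\epsilon(x)\,b(u_\epsilon)\,\nabla u_\epsilon\cdot\nabla v\,dx=\int_\Omega fv\,dx\qquad\text{for all }v\in H^1_0(\Omega),$$ and let $u_r\in V_r$ satisfy $$\int_\Omega\alpha_\epsilon(x)\,b(u_r)\,\nabla u_r\cdot\nabla v_r\,dx=\int_\Omega fv_r\,dx\qquad\text{for all }v_r\in V_r.$$ If $u_\epsilon\in W^{1,6}(\Omega)$ and $\|u_\epsilon\|_{W^{1,6}(\Omega)}\le\delta$, then $$\|\nabla(u_\epsilon-u_r)\|_{L^2(\Omega)}\le C\,\|\nabla(u_\epsilon-w_r)\|_{L^2(\Omega)}\qquad\text{for all }w_r\in V_r.$$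
   Context: $\mathcal{T}_h=\{K\}$ is a partition of $\Omega$ into finite elements $K$ (with mesh size $h$). $V_h\subset H^1_0(\Omega)$ is an associated finite-dimensional finite element subspace of piecewise polynomial functions. The bubble space is $V_b=\{v\in H^1_0(\Omega): v|_K\in H^1_0(K)\text{ for all }K\in\mathcal{T}_h\}$ and $V_r=V_h\oplus V_b$. *)

theory Defs
  imports "HOL-Analysis.Analysis"
begin

text \<open>
  Elements of Lebesgue and Sobolev spaces over an open set \<open>S\<close> are represented by total functions,
  of which only the values on \<open>S\<close> matter; no quotient by almost everywhere equality is taken.
  In particular \<open>v \<in> H10 K\<close> for \<open>K \<subseteq> S\<close> says that the restriction of \<open>v\<close> to \<open>K\<close> lies in
  \<open>H\<^sup>1\<^sub>0(K)\<close>.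
\<close>

section \<open>Lebesgue spaces\<close>

text \<open>Exponents are meant to satisfy \<open>1 \<le> p\<close>.\<close>

definition Lp_space :: "ereal \<Rightarrow> 'a::euclidean_space set \<Rightarrow> ('a \<Rightarrow> real) set" where
  "Lp_space p S = {u \<in> borel_measurable (lebesgue_on S).
     if p = \<infinity> then \<exists>M. AE x in lebesgue_on S. \<bar>u x\<bar> \<le> M
     else integrable (lebesgue_on S) (\<lambda>x. \<bar>u x\<bar> powr real_of_ereal p)}"

definition Lp_norm ::
  "real \<Rightarrow> 'a::euclidean_space set \<Rightarrow> ('a \<Rightarrow> 'b::real_normed_vector) \<Rightarrow> real" where
  "Lp_norm p S u = (LINT x|lebesgue_on S. norm (u x) powr p) powr (1 / p)"

definition locally_integrable :: "'a::euclidean_space set \<Rightarrow> ('a \<Rightarrow> real) \<Rightarrow> bool" where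
  "locally_integrable S u \<longleftrightarrow> (\<forall>C. compact C \<and> C \<subseteq> S \<longrightarrow> integrable (lebesgue_on C) u)"

section \<open>Weak derivatives and Sobolev spaces\<close>

primrec C_k :: "nat \<Rightarrow> ('a::euclidean_space \<Rightarrow> real) \<Rightarrow> bool" where
  "C_k 0 \<phi> \<longleftrightarrow> continuous_on UNIV \<phi>"
| "C_k (Suc k) \<phi> \<longleftrightarrow> \<phi> differentiable_on UNIV \<and>
     (\<forall>i\<in>Basis. C_k k (\<lambda>x. frechet_derivative \<phi> (at x) i))"

definition test_functions :: "'a::euclidean_space set \<Rightarrow> ('a \<Rightarrow> real) set" where
  "test_functions S = {\<phi>. (\<forall>k. C_k k \<phi>) \<and>
     compact (closure {x. \<phi> x \<noteq> 0}) \<and> closure {x. \<phi> x \<noteq> 0} \<subseteq> S}"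

definition has_weak_partial ::
  "'a::euclidean_space set \<Rightarrow> 'a \<Rightarrow> ('a \<Rightarrow> real) \<Rightarrow> ('a \<Rightarrow> real) \<Rightarrow> bool" where
  "has_weak_partial S i u g \<longleftrightarrow> locally_integrable S u \<and> locally_integrable S g \<and>
     (\<forall>\<phi>\<in>test_functions S.
        (LINT x|lebesgue_on S. u x * frechet_derivative \<phi> (at x) i)
          = - (LINT x|lebesgue_on S. g x * \<phi> x))"

text \<open>The weak gradient is determined only up to a null set; \<open>weak_grad\<close> picks a representative.\<close>

definition has_weak_grad ::
  "'a::euclidean_space set \<Rightarrow> ('a \<Rightarrow> real) \<Rightarrow> ('a \<Rightarrow> 'a) \<Rightarrow> bool" where
  "has_weak_grad S u G \<longleftrightarrow> (\<forall>i\<in>Basis. has_weak_partial S i u (\<lambda>x. G x \<bullet> i))"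

definition weak_grad :: "'a::euclidean_space set \<Rightarrow> ('a \<Rightarrow> real) \<Rightarrow> 'a \<Rightarrow> 'a" where
  "weak_grad S u = (SOME G. has_weak_grad S u G)"

text \<open>\<open>sobolev k p S\<close> is \<open>W\<^sup>k\<^sup>,\<^sup>p(S)\<close>.\<close>

primrec sobolev :: "nat \<Rightarrow> ereal \<Rightarrow> 'a::euclidean_space set \<Rightarrow> ('a \<Rightarrow> real) set" where
  "sobolev 0 p S = Lp_space p S"
| "sobolev (Suc k) p S =
     {u \<in> Lp_space p S. \<forall>i\<in>Basis. \<exists>g\<in>sobolev k p S. has_weak_partial S i u g}"

definition W1p_norm :: "real \<Rightarrow> 'a::euclidean_space set \<Rightarrow> ('a \<Rightarrow> real) \<Rightarrow> real" where
  "W1p_norm p S u =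
     (Lp_norm p S u powr p + (\<Sum>i\<in>Basis. Lp_norm p S (\<lambda>x. weak_grad S u x \<bullet> i) powr p)) powr (1 / p)"

text \<open>\<open>H10 S\<close> is the closure of the test functions in \<open>H\<^sup>1(S)\<close>.\<close>

definition H10 :: "'a::euclidean_space set \<Rightarrow> ('a \<Rightarrow> real) set" where
  "H10 S = {u \<in> sobolev 1 2 S.
     \<exists>\<phi>. (\<forall>n. \<phi> n \<in> test_functions S) \<and>
         (\<lambda>n. W1p_norm 2 S (\<lambda>x. u x - \<phi> n x)) \<longlonglongrightarrow> 0}"

section \<open>Polygonal domains, partitions and finite element spaces\<close>

definition polygonal_domain :: "(real^2) set \<Rightarrow> bool" where
  "polygonal_domain S \<longleftrightarrow> open S \<and> connected S \<and> S \<noteq> {} \<and>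
     (\<exists>E. finite E \<and> (\<forall>(p, q)\<in>E. p \<noteq> q) \<and> frontier S = (\<Union>(p, q)\<in>E. closed_segment p q))"

text \<open>
  The elements of a partition are represented by their interiors.  Neither convexity of the
  elements nor conformity (absence of hanging nodes) nor shape regularity is required.
\<close>

definition partition_with_mesh_size ::
  "(real^2) set \<Rightarrow> real \<Rightarrow> (real^2) set set \<Rightarrow> bool" where
  "partition_with_mesh_size \<Omega> h T \<longleftrightarrow>
     finite T \<and> (\<forall>K\<in>T. polygonal_domain K \<and> bounded K \<and> K \<subseteq> \<Omega>) \<and> pairwise disjnt T \<and>
     closure \<Omega> = (\<Union>K\<in>T. closure K) \<and> h = Max (diameter ` T)"

text \<open>
  The first conjunct says that \<open>V\<close> is the linear span of finitely many functions, i.e. a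
  finite-dimensional linear space.
\<close>

definition finite_element_space ::
  "(real^2) set \<Rightarrow> (real^2) set set \<Rightarrow> (real^2 \<Rightarrow> real) set \<Rightarrow> bool" where
  "finite_element_space \<Omega> T V \<longleftrightarrow>
     (\<exists>B. finite B \<and> V = {\<lambda>x. \<Sum>\<phi>\<in>B. c \<phi> * \<phi> x | c. True}) \<and>
     V \<subseteq> H10 \<Omega> \<and>
     (\<forall>v\<in>V. \<forall>K\<in>T. \<exists>P. real_polynomial_function P \<and> (\<forall>x\<in>K. v x = P x))"

definition bubble_space ::
  "(real^2) set \<Rightarrow> (real^2) set set \<Rightarrow> (real^2 \<Rightarrow> real) set" where
  "bubble_space \<Omega> T = {v \<in> H10 \<Omega>. \<forall>K\<in>T. v \<in> H10 K}"

text \<open>Since almost equal functions are not identified, the zero element in \<open>V \<inter> W = {0}\<close> is the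
  class of all functions vanishing almost everywhere on \<open>\<Omega>\<close>.\<close>

definition is_direct_sum ::
  "'a::euclidean_space set \<Rightarrow> ('a \<Rightarrow> real) set \<Rightarrow> ('a \<Rightarrow> real) set \<Rightarrow> ('a \<Rightarrow> real) set \<Rightarrow> bool" where
  "is_direct_sum \<Omega> U V W \<longleftrightarrow>
     U = {\<lambda>x. v x + w x | v w. v \<in> V \<and> w \<in> W} \<and>
     (\<forall>v\<in>V \<inter> W. AE x in lebesgue_on \<Omega>. v x = 0)"

end

theory Submission
  imports Defs
begin

text \<open>
  Let \<open>e = u - u\<^sub>r\<close> and \<open>d = u - w\<^sub>r\<close>. Testing both equations with \<open>w\<^sub>r - u\<^sub>r = e - d \<in> V\<^sub>r\<close> gives
  \<open>\<integral>\<alpha> b(u\<^sub>r) \<nabla>e \<bullet> \<nabla>(e - d) = \<integral>\<alpha> (b(u\<^sub>r) - b(u)) \<nabla>u \<bullet> \<nabla>(e - d)\<close>. As \<open>b\<close> is bounded and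
  Lipschitz, the left-hand side controls \<open>\<alpha>\<^sub>0 b\<^sub>0 \<parallel>\<nabla>e\<parallel>\<^sup>2 - C \<parallel>\<nabla>e\<parallel> \<parallel>\<nabla>d\<parallel>\<close> while the right-hand side is
  at most \<open>C \<parallel>e \<nabla>u\<parallel> (\<parallel>\<nabla>e\<parallel> + \<parallel>\<nabla>d\<parallel>)\<close>, with \<open>\<parallel>e \<nabla>u\<parallel> \<le> \<parallel>e\<parallel>\<^sub>4 \<parallel>\<nabla>u\<parallel>\<^sub>4 \<le> C \<delta> \<parallel>\<nabla>e\<parallel>\<close> by the Sobolev
  inequality; for small \<open>\<delta>\<close> this is absorbed on the left. The Sobolev inequality comes from Gagliardo's
  inequality \<open>\<integral>\<psi>\<^sup>2 \<le> \<integral>\<bar>\<partial>\<^sub>1\<psi>\<bar> \<integral>\<bar>\<partial>\<^sub>2\<psi>\<bar>\<close> for the test functions \<open>\<psi> = \<phi>\<close> and \<open>\<psi> = \<phi>\<^sup>2\<close>.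
  Since \<^const>\<open>weak_grad\<close> is a choice of representative, its linearity rests on the uniqueness of
  weak derivatives, that is, on the lemma of du Bois-Reymond.
\<close>

section \<open>Smooth bump functions\<close>

text \<open>The obstacle is the product e grad u. In the plane an H^1 function need not be bounded,
  so this product cannot be controlled with grad u in L^2 alone. The pairing of L^4 with L^4 is
  chosen because the fourth power of e is the square of e^2, which Gagliardo's inequality reaches
  directly; the bound of order \<delta> for grad u in L^4 comes from the sixth powers, on a domain
  of finite area. All constants are built from \<open>\<alpha>\<^sub>0\<close>,
  \<open>\<alpha>\<^sub>1\<close>, \<open>b\<^sub>0\<close>, a bound and a Lipschitz constant of
  \<open>b\<close>, and the area of \<open>\<Omega>\<close>. This is why neither the oscillation of
  the coefficient nor the mesh enters. \<open>H10\<close> is a closure, so the Sobolev inequality is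
  proved for test functions and carried to the limit by Fatou's lemma along an a.e. convergent
  subsequence. Weak gradients are known only a.e.; every identity between them is therefore an a.e.
  statement, used under the integral sign.\<close>

lemma C_k_Suc_imp_C_k: "C_k (Suc k) \<phi> \<Longrightarrow> C_k k \<phi>"
proof (induction k arbitrary: \<phi>)
  case 0
  then show ?case by (simp add: differentiable_imp_continuous_on)
next
  case (Suc k)
  then show ?case by (metis C_k.simps(2))
qed

lemma C_k_const: "C_k k (\<lambda>x. c)"
  by (induction k arbitrary: c) (auto simp: frechet_derivative_const)

lemma frechet_derivative_eqI: "(f has_derivative f') (at x) \<Longrightarrow> frechet_derivative f (at x) i = f' i"
  by (metis frechet_derivative_at)

lemma has_derivative_frechet:
  "f differentiable_on UNIV \<Longrightarrow> (f has_derivative frechet_derivative f (at x)) (at x)"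
  by (simp add: differentiable_on_def frechet_derivative_works[symmetric])

lemma C_k_add: "C_k k f \<Longrightarrow> C_k k g \<Longrightarrow> C_k k (\<lambda>x. f x + g x)"
proof (induction k arbitrary: f g)
  case 0
  then show ?case by (simp add: continuous_on_add)
next
  case (Suc k)
  then have d: "f differentiable_on UNIV" "g differentiable_on UNIV" by auto
  have "(\<lambda>x. frechet_derivative (\<lambda>x. f x + g x) (at x) i) =
    (\<lambda>x. frechet_derivative f (at x) i + frechet_derivative g (at x) i)" for i
    by (rule ext, rule frechet_derivative_eqI, rule has_derivative_add) (use d in \<open>auto intro: has_derivative_frechet\<close>)
  with Suc d show ?case by (auto simp: differentiable_on_def)
qed

lemma C_k_mult: "C_k k f \<Longrightarrow> C_k k g \<Longrightarrow> C_k k (\<lambda>x. f x * g x)"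
proof (induction k arbitrary: f g)
  case 0
  then show ?case by (simp add: continuous_on_mult)
next
  case (Suc k)
  then have d: "f differentiable_on UNIV" "g differentiable_on UNIV" by auto
  have "(\<lambda>x. frechet_derivative (\<lambda>x. f x * g x) (at x) i) =
    (\<lambda>x. f x * frechet_derivative g (at x) i + frechet_derivative f (at x) i * g x)" for i
    by (rule ext, rule frechet_derivative_eqI, rule has_derivative_mult) (use d in \<open>auto intro: has_derivative_frechet\<close>)
  moreover have "C_k k f" "C_k k g" using Suc.prems C_k_Suc_imp_C_k by blast+
  ultimately show ?case using Suc d by (auto simp: differentiable_on_def intro!: C_k_add)
qed

lemma C_k_prod: "(\<And>i. i \<in> I \<Longrightarrow> C_k k (f i)) \<Longrightarrow> C_k k (\<lambda>x. \<Prod>i\<in>I. f i x)"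
proof (induction I rule: infinite_finite_induct)
  case (insert i I)
  then show ?case by (auto intro: C_k_mult)
qed (auto simp: C_k_const)

text \<open>The classical exp(-c/t), divided by a power of t so that derivatives of members are
  linear combinations of members; smoothness then follows by one induction with \<open>m\<close>
  arbitrary. The parameter \<open>c\<close> is sent to 0 later, when bumps have to approach an
  indicator function.\<close>

definition flat :: "nat \<Rightarrow> real \<Rightarrow> real \<Rightarrow> real" where
  "flat m c t = (if 0 < t then exp (- c / t) / t ^ m else 0)"

text \<open>Substituting y = c / t turns this into the decay of y^m / exp y at infinity.\<close>

lemma flat_tendsto_0:
  assumes "0 < c" shows "(flat m c \<longlongrightarrow> 0) (at_right 0)"
proof -
  have *: "((\<lambda>y::real. y ^ m / exp y) \<longlongrightarrow> 0) at_top"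
    by (rule tendsto_power_div_exp_0)
  have "filterlim (\<lambda>t. c * inverse t) at_top (at_right (0::real))"
    using assms by (intro filterlim_tendsto_pos_mult_at_top[OF tendsto_const] filterlim_inverse_at_top_right) 
  from tendsto_mult[OF tendsto_const[of "1 / c ^ m"] filterlim_compose[OF * this]]
  have "((\<lambda>t. 1 / c ^ m * ((c * inverse t) ^ m / exp (c * inverse t))) \<longlongrightarrow> 0) (at_right 0)" by simp
  then show ?thesis
  proof (rule Lim_transform_eventually)
    show "\<forall>\<^sub>F t in at_right 0. 1 / c ^ m * ((c * inverse t) ^ m / exp (c * inverse t)) = flat m c t"
      using eventually_at_right_less[of 0] by eventually_elim (use assms in \<open>simp add: flat_def field_simps exp_minus\<close>)
  qed
qed

lemma flat_has_derivative:
  assumes "0 < c"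
  shows "(flat m c has_real_derivative c * flat (m + 2) c t - real m * flat (m + 1) c t) (at t)"
proof -
  consider "t < 0" | "t = 0" | "0 < t" by linarith
  then show ?thesis
  proof cases
    case 1
    have "((\<lambda>_. 0) has_real_derivative 0) (at t)" by simp
    then have "(flat m c has_real_derivative 0) (at t)"
      by (rule DERIV_cong_ev[THEN iffD1, rotated -1])
        (use 1 in \<open>auto intro!: eventually_mono[OF order_tendstoD(2)[OF tendsto_ident_at[of t UNIV] 1]]
           eventually_mono[OF eventually_nhds_in_open[of "{..<0}" t]] simp: flat_def\<close>)
    with 1 show ?thesis by (simp add: flat_def)
  next
    case 2
    \<comment> \<open>At the origin the difference quotient is 0 on the left, and on the right it is
      again a member of the family, with \<open>m\<close> raised by one.\<close>
    have "((\<lambda>h. flat m c h / h) \<longlongrightarrow> 0) (at 0)"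
    proof (rule filterlim_split_at)
      have "eventually (\<lambda>h. 0 = flat m c h / h) (at_left 0)"
        unfolding eventually_at_filter by (auto simp: flat_def)
      then show "((\<lambda>h. flat m c h / h) \<longlongrightarrow> 0) (at_left 0)"
        by (rule Lim_transform_eventually[OF tendsto_const])
      have "eventually (\<lambda>h. flat (Suc m) c h = flat m c h / h) (at_right 0)"
        unfolding eventually_at_filter by (auto simp: flat_def field_simps)
      then show "((\<lambda>h. flat m c h / h) \<longlongrightarrow> 0) (at_right 0)"
        by (rule Lim_transform_eventually[OF flat_tendsto_0[OF assms]])
    qed
    with 2 show ?thesis by (simp add: DERIV_def flat_def)
  next
    case 3
    have "((\<lambda>t. exp (- c / t) / t ^ m) has_real_derivative
        (exp (- c / t) * (c / t\<^sup>2) * t ^ m - exp (- c / t) * (real m * t ^ (m - 1))) / (t ^ m * t ^ m)) (at t)"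
      using 3 by (auto intro!: derivative_eq_intros simp: power2_eq_square)
    also have "(exp (- c / t) * (c / t\<^sup>2) * t ^ m - exp (- c / t) * (real m * t ^ (m - 1))) / (t ^ m * t ^ m)
       = c * flat (m + 2) c t - real m * flat (m + 1) c t"
      using 3 by (cases m) (auto simp: flat_def field_simps power2_eq_square)
    finally show ?thesis
      by (rule DERIV_cong_ev[THEN iffD1, rotated -1])
        (use 3 in \<open>auto intro!: eventually_mono[OF eventually_nhds_in_open[of "{0<..}" t]] simp: flat_def\<close>)
  qed
qed

text \<open>The affine argument serves both kinds of faces of a box: \<open>v\<close> is a basis
  vector for the lower face and its negative for the upper face.\<close>

lemma C_k_flat:
  fixes v :: "'a::euclidean_space"
  assumes "0 < c"
  shows "C_k k (\<lambda>x. flat m c (x \<bullet> v + s))"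
proof (induction k arbitrary: m)
  case 0
  have "isCont (flat m c) t" for t using flat_has_derivative[OF assms] DERIV_isCont by blast
  then have "continuous_on UNIV (flat m c)" by (simp add: continuous_on_eq_continuous_at)
  then show ?case
    by (auto intro!: continuous_on_compose2[of UNIV "flat m c"] continuous_intros)
next
  case (Suc k)
  have d: "((\<lambda>x. flat m c (x \<bullet> v + s)) has_derivative
    (\<lambda>h. (h \<bullet> v) * (c * flat (m + 2) c (x \<bullet> v + s) + - real m * flat (m + 1) c (x \<bullet> v + s)))) (at x)" for x
  proof -
    have "((\<lambda>x. x \<bullet> v + s) has_derivative (\<lambda>h. h \<bullet> v)) (at x)" by (auto intro!: derivative_eq_intros)
    from DERIV_compose_FDERIV[OF flat_has_derivative[OF assms] this]
    show ?thesis by (simp add: algebra_simps)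
  qed
  then have "(\<lambda>x. frechet_derivative (\<lambda>x. flat m c (x \<bullet> v + s)) (at x) i) =
    (\<lambda>x. (i \<bullet> v) * (c * flat (m + 2) c (x \<bullet> v + s) + - real m * flat (m + 1) c (x \<bullet> v + s)))" for i
    using frechet_derivative_eqI[OF d] by blast
  moreover have "(\<lambda>x. flat m c (x \<bullet> v + s)) differentiable_on UNIV"
    using d by (auto simp: differentiable_on_def differentiable_def)
  moreover have "C_k k (\<lambda>x. (i \<bullet> v) * (c * flat (m + 2) c (x \<bullet> v + s) + - real m * flat (m + 1) c (x \<bullet> v + s)))" for i
    by (intro C_k_mult C_k_add C_k_const Suc)
  ultimately show ?case
    unfolding C_k.simps by simp
qed

text \<open>Left without normalisation on purpose: every factor lies between 0 and 1 and tends to 1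
  on the open box as \<open>c\<close> tends to 0, so the indicator of the box is both the limit and
  a dominating function.\<close>

definition box_bump :: "'a::euclidean_space \<Rightarrow> 'a \<Rightarrow> real \<Rightarrow> 'a \<Rightarrow> real" where
  "box_bump a b c x = (\<Prod>i\<in>Basis. flat 0 c (x \<bullet> i - a \<bullet> i) * flat 0 c (b \<bullet> i - x \<bullet> i))"

lemma C_k_box_bump: "0 < c \<Longrightarrow> C_k k (box_bump a b c)"
  unfolding box_bump_def
  using C_k_flat[of c k 0 _ "- _ \<bullet> _"] C_k_flat[of c k 0 "- _"]
  by (intro C_k_prod C_k_mult) (force simp: add.commute)+

lemma flat_0_bounds: "0 < c \<Longrightarrow> 0 \<le> flat 0 c t \<and> flat 0 c t \<le> 1"
  by (auto simp: flat_def)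

lemma box_bump_nonneg: "0 < c \<Longrightarrow> 0 \<le> box_bump a b c x"
  unfolding box_bump_def by (intro prod_nonneg) (simp add: flat_0_bounds)

lemma box_bump_le_1: "0 < c \<Longrightarrow> box_bump a b c x \<le> 1"
  unfolding box_bump_def by (intro prod_le_1) (auto simp: flat_0_bounds mult_le_one)

lemma box_bump_nonzero_iff: "box_bump a b c x \<noteq> 0 \<longleftrightarrow> x \<in> box a b"
  by (force simp: box_bump_def flat_def mem_box)

lemma closure_support_subset:
  assumes "\<And>x. \<phi> x \<noteq> 0 \<Longrightarrow> x \<in> C" "closed C"
  shows "closure {x. \<phi> x \<noteq> 0} \<subseteq> C"
  by (rule closure_minimal) (use assms in auto)

lemma test_functionsI:
  assumes "\<And>k. C_k k \<phi>" "\<And>x. \<phi> x \<noteq> 0 \<Longrightarrow> x \<in> C" "compact C" "C \<subseteq> S"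
  shows "\<phi> \<in> test_functions S"
proof -
  have "closure {x. \<phi> x \<noteq> 0} \<subseteq> C" using closure_support_subset assms compact_imp_closed by metis
  moreover from this have "compact (closure {x. \<phi> x \<noteq> 0})"
    using assms(3) by (metis closed_closure compact_Int_closed inf.absorb_iff2)
  ultimately show ?thesis using assms by (auto simp: test_functions_def)
qed

lemma box_bump_test_function:
  "0 < c \<Longrightarrow> cbox a b \<subseteq> S \<Longrightarrow> box_bump a b c \<in> test_functions S"
  by (rule test_functionsI[of _ "cbox a b"]) (auto simp: C_k_box_bump box_bump_nonzero_iff intro: subsetD[OF box_subset_cbox])

lemma box_bump_tendsto_indicator:
  "(\<lambda>n. box_bump a b (1 / real (Suc n)) x) \<longlonglongrightarrow> indicator (box a b) x"
proof (cases "x \<in> box a b")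
  case True
  have *: "(\<lambda>n. flat 0 (1 / real (Suc n)) t) \<longlonglongrightarrow> 1" if "0 < t" for t
  proof -
    have "(\<lambda>n. exp (- (1 / real (Suc n)) / t)) \<longlonglongrightarrow> exp (- 0 / t)"
      using that by (intro tendsto_intros lim_1_over_n LIMSEQ_Suc) auto
    with that show ?thesis by (simp add: flat_def)
  qed
  have "(\<lambda>n. box_bump a b (1 / real (Suc n)) x) \<longlonglongrightarrow> (\<Prod>i\<in>(Basis::'a set). 1 * 1)"
    unfolding box_bump_def using True by (intro tendsto_prod tendsto_mult *) (auto simp: mem_box)
  with True show ?thesis by simp
next
  case False
  then have "box_bump a b (1 / real (Suc n)) x = 0" for n using box_bump_nonzero_iff by metis
  with False show ?thesis by simp
qed

section \<open>The fundamental lemma of the calculus of variations\<close>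

text \<open>Since \<open>ennreal\<close> cuts off negative values, the densities of \<open>f\<close>
  and \<open>- f\<close> are the positive and the negative part. Both give finite measures that
  agree on open boxes, an intersection-stable generator of the Borel sets, so the measures and hence
  the densities coincide.\<close>

lemma AE_zero_if_box_integrals_zero:
  fixes f :: "'a::euclidean_space \<Rightarrow> real"
  assumes f: "integrable lborel f"
    and zero: "\<And>l u. (LINT x|lborel. indicator (box l u) x * f x) = 0"
  shows "AE x in lborel. f x = 0"
proof -
  have [measurable]: "f \<in> borel_measurable borel"
    using borel_measurable_integrable[OF f] by simp
  have fin: "(\<integral>\<^sup>+x. ennreal (f x) \<partial>lborel) \<noteq> \<infinity>" "(\<integral>\<^sup>+x. ennreal (- f x) \<partial>lborel) \<noteq> \<infinity>"
    using f by (auto simp: real_integrable_def)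
  have box: "emeasure (density lborel (\<lambda>x. ennreal (f x))) (box l u)
      = emeasure (density lborel (\<lambda>x. ennreal (- f x))) (box l u)" for l u
  proof -
    let ?g = "\<lambda>x. indicator (box l u) x * f x"
    have g: "integrable lborel ?g"
      using integrable_mult_indicator[of "box l u" lborel f] f by simp
    have "enn2real (\<integral>\<^sup>+x. ennreal (?g x) \<partial>lborel) = enn2real (\<integral>\<^sup>+x. ennreal (- ?g x) \<partial>lborel)"
      using zero[of l u] real_lebesgue_integral_def[OF g] by simp
    moreover have "(\<integral>\<^sup>+x. ennreal (?g x) \<partial>lborel) < \<infinity>" "(\<integral>\<^sup>+x. ennreal (- ?g x) \<partial>lborel) < \<infinity>"
      using g by (auto simp: real_integrable_def top.not_eq_extremum)
    ultimately have "(\<integral>\<^sup>+x. ennreal (?g x) \<partial>lborel) = (\<integral>\<^sup>+x. ennreal (- ?g x) \<partial>lborel)"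
      by (metis ennreal_enn2real infinity_ennreal_def)
    moreover have "ennreal (?g x) = ennreal (f x) * indicator (box l u) x"
      "ennreal (- ?g x) = ennreal (- f x) * indicator (box l u) x" for x
      by (auto simp: indicator_def)
    ultimately show ?thesis by (simp add: emeasure_density)
  qed
  have "density lborel (\<lambda>x. ennreal (f x)) = density lborel (\<lambda>x. ennreal (- f x))"
  proof (rule measure_eqI_generator_eq)
    let ?E = "range (\<lambda>(a, b). box a b::'a set)"
    let ?A = "\<lambda>n::nat. box (- (real n *\<^sub>R One)) (real n *\<^sub>R One) :: 'a set"
    show "Int_stable ?E"
      by (auto simp: Int_stable_def box_Int_box)
    show "?E \<subseteq> Pow UNIV" "sets (density lborel (\<lambda>x. ennreal (f x))) = sigma_sets UNIV ?E"
      "sets (density lborel (\<lambda>x. ennreal (- f x))) = sigma_sets UNIV ?E"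
      by (simp_all add: borel_eq_box)
    show "range ?A \<subseteq> ?E" "(\<Union>i. ?A i) = UNIV"
      unfolding UN_box_eq_UNIV by auto
    show "emeasure (density lborel (\<lambda>x. ennreal (f x))) (?A i) \<noteq> \<infinity>" for i
    proof -
      have "emeasure (density lborel (\<lambda>x. ennreal (f x))) (?A i) \<le> (\<integral>\<^sup>+x. ennreal (f x) \<partial>lborel)"
        by (subst emeasure_density) (auto intro!: nn_integral_mono simp: indicator_def)
      with fin(1) show ?thesis by (auto simp: top_unique)
    qed
  qed (use box in auto)
  then have "AE x in lborel. ennreal (f x) = ennreal (- f x)"
    by (subst (asm) finite_density_unique) (use fin in auto)
  \<comment> \<open>One of the two truncated values is always 0, so their equality forces
    \<open>f x = 0\<close>.\<close>
  then show ?thesis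
  proof eventually_elim
    case (elim x)
    then show ?case by (cases "0 \<le> f x") (auto simp: ennreal_neg ennreal_eq_0_iff dest: sym)
  qed
qed

text \<open>Uniqueness of measures was argued on Borel sets; a Borel representative that agrees with
  \<open>f\<close> a.e. carries the result to the completed measure.\<close>

lemma AE_lebesgue_zero_if_box_integrals_zero:
  fixes f :: "'a::euclidean_space \<Rightarrow> real"
  assumes f: "integrable lebesgue f"
    and zero: "\<And>l u. (LINT x|lebesgue. indicator (box l u) x * f x) = 0"
  shows "AE x in lebesgue. f x = 0"
proof -
  obtain g where g[measurable]: "g \<in> borel_measurable lborel" and fg: "AE x in lborel. f x = g x"
    using completion_ex_borel_measurable_real[OF borel_measurable_integrable[OF f]] by blast
  have fg': "AE x in lebesgue. f x = g x" by (rule AE_completion[OF fg])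
  have gl: "g \<in> borel_measurable lebesgue" using g by (rule measurable_completion)
  have "integrable lebesgue g" using f gl fg' integrable_cong_AE[of f lebesgue g] by auto
  then have gi: "integrable lborel g" using integrable_completion[OF g] by blast
  have "(LINT x|lborel. indicator (box l u) x * g x) = 0" for l u
  proof -
    have "(LINT x|lborel. indicator (box l u) x * g x) = (LINT x|lebesgue. indicator (box l u) x * g x)"
      by (rule integral_completion[symmetric]) measurable
    also have "\<dots> = (LINT x|lebesgue. indicator (box l u) x * f x)"
    proof (rule integral_cong_AE)
      show "AE x in lebesgue. indicator (box l u) x * g x = indicator (box l u) x * f x"
        using fg' by eventually_elim auto
      show "(\<lambda>x. indicator (box l u) x * g x) \<in> borel_measurable lebesgue"
        by (rule measurable_completion) measurable
      have "(\<lambda>x. indicator (box l u) x *\<^sub>R f x) \<in> borel_measurable lebesgue"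
        by (intro borel_measurable_integrable integrable_mult_indicator f) simp
      then show "(\<lambda>x. indicator (box l u) x * f x) \<in> borel_measurable lebesgue" by simp
    qed
    finally show ?thesis using zero by simp
  qed
  from AE_completion[OF AE_zero_if_box_integrals_zero[OF gi this]] fg'
  show ?thesis by eventually_elim auto
qed

section \<open>Local integrability and functions of compact support\<close>

lemma integrable_lebesgue_on_iff:
  fixes f :: "'a::euclidean_space \<Rightarrow> real"
  assumes "S \<in> sets lebesgue" "\<And>x. x \<notin> S \<Longrightarrow> f x = 0"
  shows "integrable (lebesgue_on S) f \<longleftrightarrow> integrable lebesgue f"
proof -
  have "(\<lambda>x. if x \<in> S then f x else 0) = f" using assms(2) by auto
  then show ?thesis using Lebesgue_Measure.integrable_restrict_UNIV[OF assms(1), of f] by simp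
qed

lemma integral_lebesgue_on_eq:
  fixes f :: "'a::euclidean_space \<Rightarrow> real"
  assumes "S \<in> sets lebesgue" "\<And>x. x \<notin> S \<Longrightarrow> f x = 0"
  shows "(LINT x|lebesgue_on S. f x) = (LINT x|lebesgue. f x)"
proof -
  have "(\<lambda>x. if x \<in> S then f x else 0) = f" using assms(2) by auto
  then show ?thesis using Lebesgue_Measure.integral_restrict_UNIV[OF assms(1), of f] by simp
qed

lemma compact_sets_lebesgue: "compact C \<Longrightarrow> C \<in> sets (lebesgue :: 'a::euclidean_space measure)"
  by (simp add: compact_imp_closed)

lemma open_sets_lebesgue: "open C \<Longrightarrow> C \<in> sets (lebesgue :: 'a::euclidean_space measure)"
  by simp

lemma integrable_lebesgue_compact_support:
  fixes f :: "'a::euclidean_space \<Rightarrow> real"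
  assumes "compact C" "continuous_on UNIV f" "\<And>x. x \<notin> C \<Longrightarrow> f x = 0"
  shows "integrable lborel f" "integrable lebesgue f"
proof -
  have "(\<lambda>x. indicator C x *\<^sub>R f x) = f"
  proof
    show "indicator C x *\<^sub>R f x = f x" for x using assms(3) by (cases "x \<in> C") auto
  qed
  then show "integrable lborel f"
    using borel_integrable_compact[OF assms(1) continuous_on_subset[OF assms(2) subset_UNIV]] by simp
  then show "integrable lebesgue f"
    by (subst integrable_completion) (auto dest: borel_measurable_integrable)
qed

lemma locally_integrable_continuous:
  assumes "continuous_on UNIV f" shows "locally_integrable S f"
  unfolding locally_integrable_def
proof (intro allI impI)
  fix C assume C: "compact C \<and> C \<subseteq> S"
  have "integrable lborel (\<lambda>x. indicator C x *\<^sub>R f x)"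
    using C assms by (intro borel_integrable_compact) (auto intro: continuous_on_subset)
  then have "integrable lebesgue (\<lambda>x. indicator C x *\<^sub>R f x)"
    by (subst integrable_completion) (auto dest: borel_measurable_integrable)
  then show "integrable (lebesgue_on C) f"
    by (subst integrable_restrict_space) (use C compact_sets_lebesgue in auto)
qed

lemma locally_integrable_add:
  "locally_integrable S f \<Longrightarrow> locally_integrable S g \<Longrightarrow> locally_integrable S (\<lambda>x. f x + g x)"
  by (auto simp: locally_integrable_def)

lemma locally_integrable_cmult:
  "locally_integrable S f \<Longrightarrow> locally_integrable S (\<lambda>x. c * f x)"
  by (auto simp: locally_integrable_def)

lemma locally_integrable_times_continuous:
  fixes f \<psi> :: "'a::euclidean_space \<Rightarrow> real"
  assumes f: "locally_integrable S f" and \<psi>: "continuous_on UNIV \<psi>"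
    and C: "compact C" "C \<subseteq> S" "\<And>x. x \<notin> C \<Longrightarrow> \<psi> x = 0"
  shows "integrable lebesgue (\<lambda>x. f x * \<psi> x)"
proof -
  have fC: "integrable (lebesgue_on C) f" using f C by (auto simp: locally_integrable_def)
  have "compact (\<psi> ` C)" using \<psi> C by (meson compact_continuous_image continuous_on_subset subset_UNIV)
  from compact_imp_bounded[OF this] obtain B where B: "\<And>x. x \<in> C \<Longrightarrow> \<bar>\<psi> x\<bar> \<le> B"
    by (auto simp: bounded_iff)
  have "\<psi> \<in> borel_measurable lebesgue"
    using \<psi> by (intro measurable_completion) (simp add: borel_measurable_continuous_onI)
  then have [measurable]: "\<psi> \<in> borel_measurable (lebesgue_on C)" by (rule measurable_restrict_space1)
  have "integrable (lebesgue_on C) (\<lambda>x. f x * \<psi> x)"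
  proof (rule Bochner_Integration.integrable_bound)
    show "integrable (lebesgue_on C) (\<lambda>x. B * f x)" using fC by simp
    show "(\<lambda>x. f x * \<psi> x) \<in> borel_measurable (lebesgue_on C)"
      using borel_measurable_integrable[OF fC] by measurable
    show "AE x in lebesgue_on C. norm (f x * \<psi> x) \<le> norm (B * f x)"
    proof (rule AE_I2)
      fix x assume "x \<in> space (lebesgue_on C)"
      then have "\<bar>\<psi> x\<bar> \<le> \<bar>B\<bar>" using B by force
      then show "norm (f x * \<psi> x) \<le> norm (B * f x)" by (simp add: abs_mult mult.commute mult_right_mono)
    qed
  qed
  then show ?thesis
    by (subst (asm) integrable_lebesgue_on_iff) (use C compact_sets_lebesgue in auto)
qed

lemma test_function_support:
  assumes "\<phi> \<in> test_functions S"
  obtains C where "compact C" "C \<subseteq> S" "\<And>x. x \<notin> C \<Longrightarrow> \<phi> x = 0"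
proof
  show "compact (closure {x. \<phi> x \<noteq> 0})" "closure {x. \<phi> x \<noteq> 0} \<subseteq> S"
    using assms by (auto simp: test_functions_def)
  show "\<phi> x = 0" if "x \<notin> closure {x. \<phi> x \<noteq> 0}" for x
    using that closure_subset[of "{x. \<phi> x \<noteq> 0}"] by auto
qed

lemma test_function_smooth:
  assumes "\<phi> \<in> test_functions S"
  shows "\<phi> differentiable_on UNIV" "continuous_on UNIV \<phi>"
    "i \<in> Basis \<Longrightarrow> continuous_on UNIV (\<lambda>x. frechet_derivative \<phi> (at x) i)"
proof -
  have "C_k (Suc 0) \<phi>" "C_k 0 \<phi>" using assms unfolding test_functions_def by blast+
  then show "\<phi> differentiable_on UNIV" "continuous_on UNIV \<phi>"
    "i \<in> Basis \<Longrightarrow> continuous_on UNIV (\<lambda>x. frechet_derivative \<phi> (at x) i)" by auto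
qed

lemma frechet_derivative_outside_support:
  fixes \<phi> :: "'a::euclidean_space \<Rightarrow> real"
  assumes "closed C" "\<And>x. x \<notin> C \<Longrightarrow> \<phi> x = 0" "x \<notin> C"
  shows "frechet_derivative \<phi> (at x) i = 0"
proof -
  have "(\<phi> has_derivative (\<lambda>_. 0)) (at x)"
    by (rule has_derivative_transform_within_open[of "\<lambda>_. 0" _ _ _ "- C"]) (use assms in auto)
  then show ?thesis by (rule frechet_derivative_eqI)
qed

text \<open>The bumps \<^const>\<open>box_bump\<close> with parameter \<open>c \<rightarrow> 0\<close> tend to the indicator function of the box, so that
  \<open>g\<close> has integral zero over every box.\<close>

theorem du_Bois_Reymond:
  fixes g :: "'a::euclidean_space \<Rightarrow> real"
  assumes S: "open S" and g: "locally_integrable S g"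
    and zero: "\<And>\<phi>. \<phi> \<in> test_functions S \<Longrightarrow> (LINT x|lebesgue_on S. g x * \<phi> x) = 0"
  shows "AE x in lebesgue_on S. g x = 0"
proof -
  \<comment> \<open>On a closed box inside \<open>S\<close> the function \<open>g\<close> is
    integrable, by compactness, and countably many such boxes exhaust \<open>S\<close>; the a.e.
    statement can thus be proved box by box.\<close>
  obtain \<D> where \<D>: "countable \<D>" "\<D> \<subseteq> Pow S" "\<And>X. X \<in> \<D> \<Longrightarrow> \<exists>a b. X = cbox a b" "\<Union>\<D> = S"
    using open_countable_Union_open_cbox[OF S] by metis
  have gC: "integrable lebesgue (\<lambda>x. indicator C x * g x)" if "compact C" "C \<subseteq> S" for C
  proof -
    have "integrable (lebesgue_on C) g" using g that by (auto simp: locally_integrable_def)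
    then show ?thesis by (subst (asm) integrable_restrict_space) (use that compact_sets_lebesgue in auto)
  qed
  have int0: "(LINT x|lebesgue. indicator (box l u) x * g x) = 0" if "cbox l u \<subseteq> S" for l u
  proof -
    define \<epsilon> where "\<epsilon> n = 1 / real (Suc n)" for n
    have \<epsilon>: "0 < \<epsilon> n" for n by (simp add: \<epsilon>_def)
    let ?\<phi> = "\<lambda>n. box_bump l u (\<epsilon> n)"
    have "(\<lambda>n. LINT x|lebesgue. ?\<phi> n x * g x) \<longlonglongrightarrow> (LINT x|lebesgue. indicator (box l u) x * g x)"
    proof (rule integral_dominated_convergence)
      have "box l u \<in> sets lebesgue" by simp
      from integrable_mult_indicator[OF this gC[OF compact_cbox that]]
      have "integrable lebesgue (\<lambda>x. indicator (box l u) x * g x)"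
        by (rule Bochner_Integration.integrable_cong[THEN iffD1, rotated -1])
          (use box_subset_cbox[of l u] in \<open>auto simp: indicator_def\<close>)
      then show "(\<lambda>x. indicator (box l u) x * g x) \<in> borel_measurable lebesgue" by blast
      show "integrable lebesgue (\<lambda>x. norm (indicator (cbox l u) x * g x))"
        using gC[OF compact_cbox that] by (rule integrable_norm)
      show "(\<lambda>x. ?\<phi> n x * g x) \<in> borel_measurable lebesgue" for n
      proof -
        have "integrable lebesgue (\<lambda>x. g x * ?\<phi> n x)"
        proof (rule locally_integrable_times_continuous[OF g _ compact_cbox that])
          show "continuous_on UNIV (?\<phi> n)" using C_k_box_bump[OF \<epsilon>, of 0] by simp
          show "?\<phi> n x = 0" if "x \<notin> cbox l u" for x
            using that box_bump_nonzero_iff[of l u "\<epsilon> n" x] box_subset_cbox[of l u] by auto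
        qed
        then show ?thesis by (auto simp: mult.commute dest: borel_measurable_integrable)
      qed
      show "AE x in lebesgue. (\<lambda>n. ?\<phi> n x * g x) \<longlonglongrightarrow> indicator (box l u) x * g x"
        unfolding \<epsilon>_def by (intro AE_I2 tendsto_mult tendsto_const box_bump_tendsto_indicator)
      show "AE x in lebesgue. norm (?\<phi> n x * g x) \<le> norm (indicator (cbox l u) x * g x)" for n
      proof (rule AE_I2)
        fix x
        have "\<bar>?\<phi> n x\<bar> \<le> indicator (cbox l u) x"
          using box_bump_nonneg[OF \<epsilon>, of l u n x] box_bump_le_1[OF \<epsilon>, of l u n x]
            box_bump_nonzero_iff[of l u "\<epsilon> n" x] box_subset_cbox[of l u]
          by (cases "x \<in> cbox l u") auto
        then show "norm (?\<phi> n x * g x) \<le> norm (indicator (cbox l u) x * g x)"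
          by (simp add: abs_mult mult_right_mono)
      qed
    qed
    moreover have "(LINT x|lebesgue. ?\<phi> n x * g x) = 0" for n
    proof -
      have mem: "?\<phi> n \<in> test_functions S" using that \<epsilon> by (intro box_bump_test_function)
      have "(LINT x|lebesgue. ?\<phi> n x * g x) = (LINT x|lebesgue. g x * ?\<phi> n x)"
        by (rule Bochner_Integration.integral_cong[OF refl]) (rule mult.commute)
      also have "\<dots> = (LINT x|lebesgue_on S. g x * ?\<phi> n x)"
      proof (rule integral_lebesgue_on_eq[OF open_sets_lebesgue[OF S], symmetric])
        fix x assume "x \<notin> S"
        with that box_subset_cbox[of l u] have "x \<notin> box l u" by auto
        then show "g x * ?\<phi> n x = 0" using box_bump_nonzero_iff[of l u "\<epsilon> n" x] by simp
      qed
      also have "\<dots> = 0" using mem by (rule zero)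
      finally show ?thesis .
    qed
    ultimately show ?thesis by (simp add: LIMSEQ_const_iff)
  qed
  have "AE x in lebesgue. x \<in> X \<longrightarrow> g x = 0" if X: "X \<in> \<D>" for X
  proof -
    obtain a b where ab: "X = cbox a b" using \<D>(3) X by blast
    then have sub: "cbox a b \<subseteq> S" using \<D>(2) X by blast
    have "AE x in lebesgue. indicator (cbox a b) x * g x = 0"
    proof (rule AE_lebesgue_zero_if_box_integrals_zero)
      show "integrable lebesgue (\<lambda>x. indicator (cbox a b) x * g x)" by (rule gC[OF compact_cbox sub])
      fix l u
      obtain l' u' where lu: "box l u \<inter> box a b = box l' u'" using box_Int_box by blast
      \<comment> \<open>The faces of a box are a null set, so the closed box may be replaced by the
        open one, whose intersection with \<open>box l u\<close> is again an open box.\<close>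
      have "AE x in lborel. x \<notin> cbox a b - box a b"
        by (rule AE_not_in[OF null_sets_cbox_Diff_box])
      then have ae: "AE x in lebesgue. x \<notin> cbox a b - box a b" by (rule AE_completion)
      have "(LINT x|lebesgue. indicator (box l u) x * (indicator (cbox a b) x * g x))
        = (LINT x|lebesgue. indicator (box l' u') x * g x)"
      proof (rule integral_cong_AE)
        have box: "box p q \<in> sets lebesgue" for p q :: 'a by simp
        show "(\<lambda>x. indicator (box l u) x * (indicator (cbox a b) x * g x)) \<in> borel_measurable lebesgue"
          using borel_measurable_integrable[OF integrable_mult_indicator[OF box gC[OF compact_cbox sub]]] by simp
        have "indicator (box l' u') x * (indicator (cbox a b) x * g x) = indicator (box l' u') x * g x" for x
          using lu box_subset_cbox[of a b] by (cases "x \<in> box l' u'") auto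
        then have eq: "(\<lambda>x. indicator (box l' u') x * (indicator (cbox a b) x * g x)) = (\<lambda>x. indicator (box l' u') x * g x)"
          by (rule ext)
        show "(\<lambda>x. indicator (box l' u') x * g x) \<in> borel_measurable lebesgue"
          using borel_measurable_integrable[OF integrable_mult_indicator[OF box[of l' u'] gC[OF compact_cbox sub]]]
          unfolding real_scaleR_def eq .
        show "AE x in lebesgue. indicator (box l u) x * (indicator (cbox a b) x * g x) = indicator (box l' u') x * g x"
          using ae
        proof eventually_elim
          case (elim x)
          have "x \<in> box l' u' \<longleftrightarrow> x \<in> box l u \<and> x \<in> box a b" using lu by blast
          moreover have "x \<in> cbox a b \<longleftrightarrow> x \<in> box a b" using elim box_subset_cbox[of a b] by blast
          ultimately show ?case by (cases "x \<in> box l u"; cases "x \<in> box a b") simp_all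
        qed
      qed
      also have "\<dots> = 0"
      \<comment> \<open>The empty case is split off because a degenerate \<open>cbox l' u'\<close>
        may be nonempty and leave \<open>S\<close>, whereas a nonempty open box has the closed box
        as its closure.\<close>
      proof (cases "box l' u' = {}")
        case False
        then have "cbox l' u' = closure (box l' u')" by (simp add: closure_box)
        also have "\<dots> \<subseteq> cbox a b" using lu box_subset_cbox[of a b] by (intro closure_minimal) auto
        finally show ?thesis using sub by (intro int0) auto
      qed simp
      finally show "(LINT x|lebesgue. indicator (box l u) x * (indicator (cbox a b) x * g x)) = 0" .
    qed
    then show ?thesis by eventually_elim (auto simp: ab)
  qed
  then have "AE x in lebesgue. \<forall>X\<in>\<D>. x \<in> X \<longrightarrow> g x = 0"
    unfolding AE_ball_countable[OF \<D>(1)] by blast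
  then have "AE x in lebesgue. x \<in> S \<longrightarrow> g x = 0"
    by (rule eventually_mono) (use \<D>(4) in blast)
  then show ?thesis
    using AE_restrict_space_iff[of S lebesgue] open_sets_lebesgue[OF S] by simp
qed

section \<open>Calculus of weak derivatives\<close>

lemma integral_lborel_translate:
  fixes f :: "'a::euclidean_space \<Rightarrow> real"
  assumes [measurable]: "f \<in> borel_measurable borel"
  shows "(LINT x|lborel. f (x + c)) = (LINT x|lborel. f x)"
proof -
  have "(LINT x|lborel. f x) = (LINT x|distr lborel borel ((+) c). f x)"
    by (simp only: lborel_distr_plus)
  also have "\<dots> = (LINT x|lborel. f (c + x))" by (rule integral_distr) auto
  finally show ?thesis by (simp add: add.commute)
qed

text \<open>Reduces a partial derivative to a derivative in one real variable, so that the mean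
  value theorem and the fundamental theorem of calculus become available.\<close>

lemma partial_along_line:
  assumes "\<phi> differentiable_on UNIV"
  shows "((\<lambda>s. \<phi> (x + s *\<^sub>R i)) has_real_derivative frechet_derivative \<phi> (at (x + s *\<^sub>R i)) i) (at s)"
proof -
  let ?D = "frechet_derivative \<phi> (at (x + s *\<^sub>R i))"
  have D: "(\<phi> has_derivative ?D) (at (x + s *\<^sub>R i))" by (rule has_derivative_frechet[OF assms])
  have "((\<lambda>s. x + s *\<^sub>R i) has_derivative (\<lambda>h. h *\<^sub>R i)) (at s)"
    by (auto intro!: derivative_eq_intros)
  from has_derivative_compose[OF this D]
  have "((\<lambda>s. \<phi> (x + s *\<^sub>R i)) has_derivative (\<lambda>h. ?D (h *\<^sub>R i))) (at s)" .
  moreover have "?D (h *\<^sub>R i) = ?D i * h" for h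
    using linear_cmul[OF has_derivative_linear[OF D]] by (simp add: mult.commute)
  ultimately show ?thesis by (simp add: has_field_derivative_def)
qed

lemma bounded_compact_support:
  fixes f :: "'a::euclidean_space \<Rightarrow> real"
  assumes "continuous_on UNIV f" "compact C" "\<And>x. x \<notin> C \<Longrightarrow> f x = 0"
  obtains B where "0 \<le> B" "\<And>x. \<bar>f x\<bar> \<le> B"
proof -
  have "compact (f ` C)" using assms by (meson compact_continuous_image continuous_on_subset subset_UNIV)
  from compact_imp_bounded[OF this] obtain B where B: "\<And>x. x \<in> C \<Longrightarrow> \<bar>f x\<bar> \<le> B"
    by (auto simp: bounded_iff)
  have "\<bar>f x\<bar> \<le> \<bar>B\<bar>" for x using B[of x] assms(3)[of x] by (cases "x \<in> C") auto
  then show ?thesis using that[of "\<bar>B\<bar>"] by simp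
qed

text \<open>The difference quotients of \<open>\<phi>\<close> have integral zero by translation invariance, and they converge
  dominatedly to the partial derivative.\<close>

lemma integral_partial_derivative_eq_0:
  fixes \<phi> :: "'a::euclidean_space \<Rightarrow> real"
  assumes d: "\<phi> differentiable_on UNIV" and i: "i \<in> Basis"
    and cont: "continuous_on UNIV (\<lambda>x. frechet_derivative \<phi> (at x) i)"
    and C: "compact C" "\<And>x. x \<notin> C \<Longrightarrow> \<phi> x = 0"
  shows "(LINT x|lebesgue. frechet_derivative \<phi> (at x) i) = 0"
proof -
  let ?D = "\<lambda>x. frechet_derivative \<phi> (at x) i"
  have D0: "?D x = 0" if "x \<notin> C" for x
    using frechet_derivative_outside_support[OF compact_imp_closed[OF C(1)] C(2) that] .
  obtain B where B: "0 \<le> B" "\<And>x. \<bar>?D x\<bar> \<le> B"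
    using bounded_compact_support[OF cont C(1) D0] by metis
  obtain R where R: "\<And>x. x \<in> C \<Longrightarrow> norm x \<le> R"
    using compact_imp_bounded[OF C(1)] by (auto simp: bounded_iff)
  have contphi: "continuous_on UNIV \<phi>" using d by (rule differentiable_imp_continuous_on)
  then have [measurable]: "\<phi> \<in> borel_measurable borel" by (rule borel_measurable_continuous_onI)
  have [measurable]: "?D \<in> borel_measurable borel" using cont by (rule borel_measurable_continuous_onI)
  define h where "h n = 1 / real (Suc n)" for n
  have h: "0 < h n" "h n \<le> 1" for n by (auto simp: h_def)
  define q where "q n x = (\<phi> (x + h n *\<^sub>R i) - \<phi> x) / h n" for n x
  have [measurable]: "q n \<in> borel_measurable borel" for n unfolding q_def by measurable
  have "(\<lambda>n. LINT x|lborel. q n x) \<longlonglongrightarrow> (LINT x|lborel. ?D x)"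
  proof (rule integral_dominated_convergence)
    \<comment> \<open>The dominating function: the mean value theorem bounds each quotient by
      \<open>B\<close>, and since the steps \<open>h n\<close> are at most 1, the quotient vanishes
      outside the ball of radius \<open>R + 1\<close>.\<close>
    show "integrable lborel (\<lambda>x. B * indicator (cball (0::'a) (R + 1)) x)"
      using emeasure_lborel_cball_finite[of "0::'a" "R + 1"] by (intro integrable_mult_right integrable_real_indicator) auto
    have "h \<longlonglongrightarrow> 0" unfolding h_def using LIMSEQ_Suc[OF lim_1_over_n] by simp
    then have hlim: "filterlim h (at 0) sequentially"
      by (intro filterlim_atI) (use h in \<open>auto simp: less_imp_neq[symmetric] intro!: always_eventually\<close>)
    show "AE x in lborel. (\<lambda>n. q n x) \<longlonglongrightarrow> ?D x"
    proof (rule AE_I2)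
      fix x
      have "((\<lambda>t. (\<phi> (x + t *\<^sub>R i) - \<phi> x) / t) \<longlongrightarrow> ?D x) (at 0)"
        using partial_along_line[OF d, of x i 0] by (simp add: DERIV_def)
      from filterlim_compose[OF this hlim] show "(\<lambda>n. q n x) \<longlonglongrightarrow> ?D x" by (simp add: q_def)
    qed
    show "AE x in lborel. norm (q n x) \<le> B * indicator (cball 0 (R + 1)) x" for n
    proof (rule AE_I2)
      fix x
      show "norm (q n x) \<le> B * indicator (cball 0 (R + 1)) x"
      proof (cases "norm x \<le> R + 1")
        case True
        obtain z where "\<phi> (x + h n *\<^sub>R i) - \<phi> (x + 0 *\<^sub>R i) = (h n - 0) * ?D (x + z *\<^sub>R i)"
          using MVT2[OF h(1)[of n] partial_along_line[OF d]] by blast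
        then have "q n x = ?D (x + z *\<^sub>R i)" using h(1)[of n] by (simp add: q_def)
        with B(2) True show ?thesis by simp
      next
        case False
        have "norm (x + h n *\<^sub>R i) \<ge> norm x - h n * norm i"
          using norm_diff_ineq[of x "h n *\<^sub>R i"] h(1)[of n] by simp
        then have "norm (x + h n *\<^sub>R i) > R" using False h(2)[of n] i by simp
        moreover have "norm x > R" using False by simp
        ultimately have "x + h n *\<^sub>R i \<notin> C" "x \<notin> C" using R by force+
        then show ?thesis using C(2) B(1) by (simp add: q_def)
      qed
    qed
  qed measurable
  moreover have "(LINT x|lborel. q n x) = 0" for n
  proof -
    have i1: "integrable lborel \<phi>" by (rule integrable_lebesgue_compact_support[OF C(1) contphi C(2)])
    have "continuous_on UNIV (\<lambda>x. \<phi> (x + h n *\<^sub>R i))"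
      by (intro continuous_on_compose2[OF contphi] continuous_intros) auto
    moreover have "compact ((\<lambda>x. x - h n *\<^sub>R i) ` C)"
      using C(1) by (intro compact_continuous_image continuous_intros)
    moreover have "\<phi> (x + h n *\<^sub>R i) = 0" if "x \<notin> (\<lambda>x. x - h n *\<^sub>R i) ` C" for x
      using that by (intro C(2)) (auto simp: image_iff)
    ultimately have i2: "integrable lborel (\<lambda>x. \<phi> (x + h n *\<^sub>R i))"
      using integrable_lebesgue_compact_support(1) by blast
    show ?thesis
      unfolding q_def using i1 i2 integral_lborel_translate[of \<phi> "h n *\<^sub>R i"] by simp
  qed
  ultimately have "(LINT x|lborel. ?D x) = 0" by (simp add: LIMSEQ_const_iff)
  then show ?thesis by (subst integral_completion) auto
qed

text \<open>Integration by parts: the product with a test function has compact support even if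
  \<open>\<phi>\<close> has not, so the integral of its partial derivative is 0, and the product
  rule splits it.\<close>

lemma has_weak_partial_C1:
  fixes \<phi> :: "'a::euclidean_space \<Rightarrow> real"
  assumes S: "open S" and \<phi>: "C_k 1 \<phi>" and i: "i \<in> Basis"
  shows "has_weak_partial S i \<phi> (\<lambda>x. frechet_derivative \<phi> (at x) i)"
  unfolding has_weak_partial_def
proof (intro conjI ballI)
  let ?D = "\<lambda>f x. frechet_derivative f (at x) i"
  have d: "\<phi> differentiable_on UNIV" and cD: "continuous_on UNIV (?D \<phi>)" using \<phi> i by auto
  have c: "continuous_on UNIV \<phi>" using d by (rule differentiable_imp_continuous_on)
  show l: "locally_integrable S \<phi>" "locally_integrable S (?D \<phi>)"
    using c cD by (auto intro: locally_integrable_continuous)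
  fix \<psi> assume \<psi>: "\<psi> \<in> test_functions S"
  note sm = test_function_smooth[OF \<psi>]
  obtain C where C: "compact C" "C \<subseteq> S" "\<And>x. x \<notin> C \<Longrightarrow> \<psi> x = 0" using test_function_support[OF \<psi>] by metis
  have D0: "?D \<psi> x = 0" if "x \<notin> C" for x
    using frechet_derivative_outside_support[OF compact_imp_closed[OF C(1)] C(3) that] .
  have eq: "?D (\<lambda>x. \<phi> x * \<psi> x) x = \<phi> x * ?D \<psi> x + ?D \<phi> x * \<psi> x" for x
    by (rule frechet_derivative_eqI, rule has_derivative_mult) (use d sm(1) in \<open>auto intro: has_derivative_frechet\<close>)
  have "(LINT x|lebesgue. ?D (\<lambda>x. \<phi> x * \<psi> x) x) = 0"
  proof (rule integral_partial_derivative_eq_0[OF _ i _ C(1)])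
    show "(\<lambda>x. \<phi> x * \<psi> x) differentiable_on UNIV" using d sm(1) by (auto simp: differentiable_on_def)
    show "continuous_on UNIV (?D (\<lambda>x. \<phi> x * \<psi> x))"
      unfolding eq by (intro continuous_intros c cD sm i)
  qed (use C in auto)
  moreover have i1: "integrable lebesgue (\<lambda>x. \<phi> x * ?D \<psi> x)"
    using locally_integrable_times_continuous[OF l(1) sm(3)[OF i] C(1,2) D0] .
  moreover have i2: "integrable lebesgue (\<lambda>x. ?D \<phi> x * \<psi> x)"
    using locally_integrable_times_continuous[OF l(2) sm(2) C] .
  ultimately have "(LINT x|lebesgue. \<phi> x * ?D \<psi> x) + (LINT x|lebesgue. ?D \<phi> x * \<psi> x) = 0"
    unfolding eq by simp
  moreover have "(LINT x|lebesgue_on S. \<phi> x * ?D \<psi> x) = (LINT x|lebesgue. \<phi> x * ?D \<psi> x)"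
    by (rule integral_lebesgue_on_eq) (use S D0 C in auto)
  moreover have "(LINT x|lebesgue_on S. ?D \<phi> x * \<psi> x) = (LINT x|lebesgue. ?D \<phi> x * \<psi> x)"
    by (rule integral_lebesgue_on_eq) (use S C in auto)
  ultimately show "(LINT x|lebesgue_on S. \<phi> x * ?D \<psi> x) = - (LINT x|lebesgue_on S. ?D \<phi> x * \<psi> x)" by simp
qed

section \<open>Linearity and uniqueness of weak derivatives\<close>

lemma locally_integrable_times_test:
  fixes f :: "'a::euclidean_space \<Rightarrow> real"
  assumes S: "open S" and f: "locally_integrable S f" and \<psi>: "\<psi> \<in> test_functions S"
  shows "integrable (lebesgue_on S) (\<lambda>x. f x * \<psi> x)"
    "i \<in> Basis \<Longrightarrow> integrable (lebesgue_on S) (\<lambda>x. f x * frechet_derivative \<psi> (at x) i)"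
proof -
  note sm = test_function_smooth[OF \<psi>]
  obtain C where C: "compact C" "C \<subseteq> S" "\<And>x. x \<notin> C \<Longrightarrow> \<psi> x = 0" using test_function_support[OF \<psi>] by metis
  have D0: "frechet_derivative \<psi> (at x) i = 0" if "x \<notin> C" for x
    using frechet_derivative_outside_support[OF compact_imp_closed[OF C(1)] C(3) that] .
  show "integrable (lebesgue_on S) (\<lambda>x. f x * \<psi> x)"
    by (subst integrable_lebesgue_on_iff)
      (use S C locally_integrable_times_continuous[OF f sm(2) C] in auto)
  show "integrable (lebesgue_on S) (\<lambda>x. f x * frechet_derivative \<psi> (at x) i)" if i: "i \<in> Basis"
    by (subst integrable_lebesgue_on_iff)
      (use S C D0 locally_integrable_times_continuous[OF f sm(3)[OF i] C(1,2) D0] in auto)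
qed

lemma has_weak_partial_add:
  assumes S: "open S" and i: "i \<in> Basis" and u: "has_weak_partial S i u g" and v: "has_weak_partial S i v h"
  shows "has_weak_partial S i (\<lambda>x. u x + v x) (\<lambda>x. g x + h x)"
  unfolding has_weak_partial_def
proof (intro conjI ballI)
  note u = u[unfolded has_weak_partial_def] and v = v[unfolded has_weak_partial_def]
  show "locally_integrable S (\<lambda>x. u x + v x)" "locally_integrable S (\<lambda>x. g x + h x)"
    using u v by (auto intro: locally_integrable_add)
  fix \<phi> assume \<phi>: "\<phi> \<in> test_functions S"
  show "(LINT x|lebesgue_on S. (u x + v x) * frechet_derivative \<phi> (at x) i) = - (LINT x|lebesgue_on S. (g x + h x) * \<phi> x)"
    using u v \<phi> i S by (simp add: distrib_right locally_integrable_times_test)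
qed

lemma has_weak_partial_cmult:
  assumes u: "has_weak_partial S i u g"
  shows "has_weak_partial S i (\<lambda>x. c * u x) (\<lambda>x. c * g x)"
  using u by (auto simp: has_weak_partial_def mult.assoc intro: locally_integrable_cmult)

lemma has_weak_partial_unique:
  assumes S: "open S" and i: "i \<in> Basis" and g: "has_weak_partial S i u g" and h: "has_weak_partial S i u h"
  shows "AE x in lebesgue_on S. g x = h x"
proof -
  have "AE x in lebesgue_on S. g x + (-1) * h x = 0"
  proof (rule du_Bois_Reymond[OF S])
    have l: "locally_integrable S g" "locally_integrable S h" using g h by (auto simp: has_weak_partial_def)
    show "locally_integrable S (\<lambda>x. g x + (-1) * h x)" by (intro locally_integrable_add locally_integrable_cmult l)
    fix \<phi> assume \<phi>: "\<phi> \<in> test_functions S"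
    have "(LINT x|lebesgue_on S. g x * \<phi> x) = (LINT x|lebesgue_on S. h x * \<phi> x)"
      using g h \<phi> unfolding has_weak_partial_def by (metis minus_minus)
    then show "(LINT x|lebesgue_on S. (g x + (-1) * h x) * \<phi> x) = 0"
      using locally_integrable_times_test(1)[OF S l(1) \<phi>] locally_integrable_times_test(1)[OF S l(2) \<phi>]
      by (simp add: left_diff_distrib)
  qed
  then show ?thesis by eventually_elim simp
qed

lemma has_weak_grad_add:
  "open S \<Longrightarrow> has_weak_grad S u G \<Longrightarrow> has_weak_grad S v H \<Longrightarrow> has_weak_grad S (\<lambda>x. u x + v x) (\<lambda>x. G x + H x)"
  by (simp add: has_weak_grad_def inner_add_left has_weak_partial_add)

lemma has_weak_grad_cmult:
  "has_weak_grad S u G \<Longrightarrow> has_weak_grad S (\<lambda>x. c * u x) (\<lambda>x. c *\<^sub>R G x)"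
  by (simp add: has_weak_grad_def has_weak_partial_cmult)

lemma has_weak_grad_diff:
  assumes "open S" "has_weak_grad S u G" "has_weak_grad S v H"
  shows "has_weak_grad S (\<lambda>x. u x - v x) (\<lambda>x. G x - H x)"
  using has_weak_grad_add[OF assms(1,2) has_weak_grad_cmult[OF assms(3), of "-1"]] by simp

lemma has_weak_grad_weak_grad: "has_weak_grad S u G \<Longrightarrow> has_weak_grad S u (weak_grad S u)"
  unfolding weak_grad_def by (metis someI)

text \<open>This makes the chosen representative computable: a weak gradient obtained by calculus,
  such as a difference of gradients, may replace it a.e.\<close>

lemma weak_grad_unique:
  fixes G :: "'a::euclidean_space \<Rightarrow> 'a"
  assumes S: "open S" and G: "has_weak_grad S u G"
  shows "AE x in lebesgue_on S. weak_grad S u x = G x"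
proof -
  have "AE x in lebesgue_on S. weak_grad S u x \<bullet> i = G x \<bullet> i" if "i \<in> Basis" for i
    using has_weak_grad_weak_grad[OF G] G that unfolding has_weak_grad_def
    by (intro has_weak_partial_unique[OF S that, of u]) blast+
  then have "AE x in lebesgue_on S. \<forall>i\<in>Basis. weak_grad S u x \<bullet> i = G x \<bullet> i"
    by (simp add: AE_finite_all)
  then show ?thesis by eventually_elim (auto intro: euclidean_eqI)
qed

lemma has_weak_grad_C1:
  assumes "open S" "C_k 1 \<phi>"
  shows "has_weak_grad S \<phi> (\<lambda>x. \<Sum>i\<in>Basis. frechet_derivative \<phi> (at x) i *\<^sub>R i)"
  unfolding has_weak_grad_def using has_weak_partial_C1[OF assms] by simp

section \<open>The spaces \<open>H\<^sup>1\<close> and \<open>H\<^sup>1\<^sub>0\<close>\<close>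

text \<open>Completeness of Lebesgue measure, after extension by zero. Measurability of
  \<open>weak_grad\<close>, itself an arbitrary choice, is inherited in this way from an explicit
  representative.\<close>

lemma borel_measurable_lebesgue_on_AE:
  fixes f :: "'a::euclidean_space \<Rightarrow> 'b::euclidean_space"
  assumes S: "S \<in> sets lebesgue" and f: "f \<in> borel_measurable (lebesgue_on S)"
    and ae: "AE x in lebesgue_on S. f x = g x"
  shows "g \<in> borel_measurable (lebesgue_on S)"
proof -
  have "AE x in lebesgue. x \<in> S \<longrightarrow> f x = g x"
    using ae S by (simp add: AE_restrict_space_iff)
  then have "AE x in lebesgue. (if x \<in> S then f x else 0) = (if x \<in> S then g x else 0)"
    by eventually_elim auto
  with borel_measurable_if_I[OF f S] show ?thesis
    by (rule borel_measurable_if_D[OF borel_measurable_AE])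
qed

lemma Lp_space_AE:
  assumes S: "S \<in> sets lebesgue" and u: "u \<in> Lp_space p S" and ae: "AE x in lebesgue_on S. u x = v x"
  shows "v \<in> Lp_space p S"
proof -
  have [measurable]: "u \<in> borel_measurable (lebesgue_on S)" using u by (simp add: Lp_space_def)
  have [measurable]: "v \<in> borel_measurable (lebesgue_on S)"
    by (rule borel_measurable_lebesgue_on_AE[OF S _ ae]) measurable
  show ?thesis
  proof (cases "p = \<infinity>")
    case True
    with u obtain M where "AE x in lebesgue_on S. \<bar>u x\<bar> \<le> M" by (auto simp: Lp_space_def)
    with ae have "AE x in lebesgue_on S. \<bar>v x\<bar> \<le> M" by eventually_elim simp
    with True show ?thesis by (auto simp: Lp_space_def)
  next
    case False
    have "integrable (lebesgue_on S) (\<lambda>x. \<bar>u x\<bar> powr real_of_ereal p)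
      \<longleftrightarrow> integrable (lebesgue_on S) (\<lambda>x. \<bar>v x\<bar> powr real_of_ereal p)"
      by (rule integrable_cong_AE) (measurable, use ae in \<open>auto elim: eventually_mono\<close>)
    with False u show ?thesis by (simp add: Lp_space_def)
  qed
qed

lemma Lp_space_even:
  assumes "even n" "0 < n"
  shows "u \<in> Lp_space (ereal (real n)) S \<longleftrightarrow>
    u \<in> borel_measurable (lebesgue_on S) \<and> integrable (lebesgue_on S) (\<lambda>x. u x ^ n)"
  using assms by (simp add: Lp_space_def powr_realpow' power_even_abs)

lemma Lp_space_2_iff:
  "u \<in> Lp_space (ereal 2) S \<longleftrightarrow> u \<in> borel_measurable (lebesgue_on S) \<and> integrable (lebesgue_on S) (\<lambda>x. (u x)\<^sup>2)"
  using Lp_space_even[of 2 u S] by simp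

lemma Lp_space_6_iff:
  "u \<in> Lp_space (ereal 6) S \<longleftrightarrow> u \<in> borel_measurable (lebesgue_on S) \<and> integrable (lebesgue_on S) (\<lambda>x. u x ^ 6)"
  using Lp_space_even[of 6 u S] by simp

text \<open>Membership in \<open>sobolev\<close> supplies the partial derivatives one direction at a
  time. Assembled into a vector field they witness that a weak gradient exists, so that the choice
  in \<open>weak_grad\<close> is meaningful; its components then inherit membership in L^p by a.e.
  equality.\<close>

lemma sobolev_1_has_weak_grad:
  fixes u :: "'a::euclidean_space \<Rightarrow> real"
  assumes S: "open S" and u: "u \<in> sobolev 1 p S"
  shows "has_weak_grad S u (weak_grad S u)" "i \<in> Basis \<Longrightarrow> (\<lambda>x. weak_grad S u x \<bullet> i) \<in> Lp_space p S"
proof -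
  from u have "\<forall>i\<in>Basis. \<exists>g\<in>Lp_space p S. has_weak_partial S i u g" by simp
  then obtain g where g: "\<And>i. i \<in> Basis \<Longrightarrow> g i \<in> Lp_space p S" "\<And>i. i \<in> Basis \<Longrightarrow> has_weak_partial S i u (g i)"
    by metis
  define G where "G x = (\<Sum>i\<in>Basis. g i x *\<^sub>R i)" for x
  have Gi: "G x \<bullet> i = g i x" if "i \<in> Basis" for x i using that by (simp add: G_def)
  have G: "has_weak_grad S u G" using g Gi by (simp add: has_weak_grad_def)
  then show "has_weak_grad S u (weak_grad S u)" by (rule has_weak_grad_weak_grad)
  show "(\<lambda>x. weak_grad S u x \<bullet> i) \<in> Lp_space p S" if i: "i \<in> Basis"
  proof (rule Lp_space_AE[OF open_sets_lebesgue[OF S] g(1)[OF i]])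
    show "AE x in lebesgue_on S. g i x = weak_grad S u x \<bullet> i"
      using weak_grad_unique[OF S G] by eventually_elim (simp add: Gi i)
  qed
qed

lemma norm_square_eq_sum_Basis: "(norm (x::'a::euclidean_space))\<^sup>2 = (\<Sum>i\<in>Basis. (x \<bullet> i)\<^sup>2)"
  unfolding power2_norm_eq_inner by (subst euclidean_inner) (simp add: power2_eq_square)

lemma sobolev_1_2D:
  fixes u :: "'a::euclidean_space \<Rightarrow> real"
  assumes S: "open S" and u: "u \<in> sobolev 1 2 S"
  shows "u \<in> borel_measurable (lebesgue_on S)" "integrable (lebesgue_on S) (\<lambda>x. (u x)\<^sup>2)"
    "has_weak_grad S u (weak_grad S u)"
    "weak_grad S u \<in> borel_measurable (lebesgue_on S)"
    "integrable (lebesgue_on S) (\<lambda>x. (norm (weak_grad S u x))\<^sup>2)"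
proof -
  show "u \<in> borel_measurable (lebesgue_on S)" "integrable (lebesgue_on S) (\<lambda>x. (u x)\<^sup>2)"
    using u by (simp_all add: Lp_space_2_iff)
  show "has_weak_grad S u (weak_grad S u)" by (rule sobolev_1_has_weak_grad[OF assms])
  have "(\<lambda>x. weak_grad S u x \<bullet> i) \<in> borel_measurable (lebesgue_on S)"
    "integrable (lebesgue_on S) (\<lambda>x. (weak_grad S u x \<bullet> i)\<^sup>2)" if "i \<in> Basis" for i
    using sobolev_1_has_weak_grad(2)[OF assms that] by (simp_all add: Lp_space_2_iff)
  then show "weak_grad S u \<in> borel_measurable (lebesgue_on S)"
    "integrable (lebesgue_on S) (\<lambda>x. (norm (weak_grad S u x))\<^sup>2)"
    by (simp_all add: borel_measurable_euclidean_space[of "weak_grad S u"] norm_square_eq_sum_Basis)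
qed

lemma sobolev_1_2I:
  fixes u :: "'a::euclidean_space \<Rightarrow> real"
  assumes "u \<in> borel_measurable (lebesgue_on S)" "integrable (lebesgue_on S) (\<lambda>x. (u x)\<^sup>2)"
    "has_weak_grad S u G" "G \<in> borel_measurable (lebesgue_on S)"
    "integrable (lebesgue_on S) (\<lambda>x. (norm (G x))\<^sup>2)"
  shows "u \<in> sobolev 1 2 S"
proof -
  have "(\<lambda>x. G x \<bullet> i) \<in> Lp_space 2 S" if i: "i \<in> Basis" for i
  proof -
    have [measurable]: "(\<lambda>x. G x \<bullet> i) \<in> borel_measurable (lebesgue_on S)" using assms(4) by measurable
    have "integrable (lebesgue_on S) (\<lambda>x. (G x \<bullet> i)\<^sup>2)"
    proof (rule Bochner_Integration.integrable_bound[OF assms(5)])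
      have "(G x \<bullet> i)\<^sup>2 \<le> (norm (G x))\<^sup>2" for x
        using Basis_le_norm[OF i, of "G x"] by (metis abs_ge_zero power2_abs power_mono)
      then show "AE x in lebesgue_on S. norm ((G x \<bullet> i)\<^sup>2) \<le> norm ((norm (G x))\<^sup>2)" by simp
    qed measurable
    then show ?thesis by (simp add: Lp_space_2_iff)
  qed
  then show ?thesis using assms(1-3) by (auto simp: Lp_space_2_iff has_weak_grad_def)
qed

text \<open>The square of the H^1 norm. In this form the triangle inequality becomes |x + y|^2 <= 2
  |x|^2 + 2 |y|^2 under the integral; the factor 2 is harmless because only convergence to 0 is at
  stake.\<close>

definition h1_energy :: "'a::euclidean_space set \<Rightarrow> ('a \<Rightarrow> real) \<Rightarrow> real" where
  "h1_energy S u = (LINT x|lebesgue_on S. (u x)\<^sup>2) + (LINT x|lebesgue_on S. (norm (weak_grad S u x))\<^sup>2)"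

lemma h1_energy_nonneg: "0 \<le> h1_energy S u"
  by (simp add: h1_energy_def)

lemma Lp_norm_2: "Lp_norm 2 S u = sqrt (LINT x|lebesgue_on S. (norm (u x))\<^sup>2)"
  by (simp add: Lp_norm_def powr_half_sqrt integral_nonneg_AE)

lemma W1p_norm_2:
  assumes S: "open S" and u: "u \<in> sobolev 1 2 S"
  shows "W1p_norm 2 S u = sqrt (h1_energy S u)"
proof -
  have "integrable (lebesgue_on S) (\<lambda>x. (weak_grad S u x \<bullet> i)\<^sup>2)" if "i \<in> Basis" for i
    using sobolev_1_has_weak_grad(2)[OF assms that] by (simp_all add: Lp_space_2_iff)
  then have "(LINT x|lebesgue_on S. (norm (weak_grad S u x))\<^sup>2) = (\<Sum>i\<in>Basis. LINT x|lebesgue_on S. (weak_grad S u x \<bullet> i)\<^sup>2)"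
    by (simp add: norm_square_eq_sum_Basis)
  then show ?thesis
    by (simp add: W1p_norm_def Lp_norm_2 powr_half_sqrt h1_energy_def sum_nonneg)
qed

lemma square_norm_add_le: "(norm (x + y))\<^sup>2 \<le> 2 * (norm x)\<^sup>2 + 2 * (norm y)\<^sup>2"
proof -
  have "(norm (x + y))\<^sup>2 \<le> (norm x + norm y)\<^sup>2" by (simp add: norm_triangle_ineq power_mono)
  also have "\<dots> \<le> 2 * (norm x)\<^sup>2 + 2 * (norm y)\<^sup>2"
    using sum_squares_bound[of "norm x" "norm y"] by (simp add: power2_sum)
  finally show ?thesis .
qed

lemma integrable_square_norm_add:
  fixes f g :: "'a \<Rightarrow> 'b::euclidean_space"
  assumes [measurable]: "f \<in> borel_measurable M" "g \<in> borel_measurable M"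
    and int: "integrable M (\<lambda>x. (norm (f x))\<^sup>2)" "integrable M (\<lambda>x. (norm (g x))\<^sup>2)"
  shows "integrable M (\<lambda>x. (norm (f x + g x))\<^sup>2)"
    "(LINT x|M. (norm (f x + g x))\<^sup>2) \<le> 2 * (LINT x|M. (norm (f x))\<^sup>2) + 2 * (LINT x|M. (norm (g x))\<^sup>2)"
proof -
  have i: "integrable M (\<lambda>x. 2 * (norm (f x))\<^sup>2 + 2 * (norm (g x))\<^sup>2)" using int by simp
  show i2: "integrable M (\<lambda>x. (norm (f x + g x))\<^sup>2)"
    by (rule Bochner_Integration.integrable_bound[OF i]) (measurable, use square_norm_add_le in auto)
  have "(LINT x|M. (norm (f x + g x))\<^sup>2) \<le> (LINT x|M. 2 * (norm (f x))\<^sup>2 + 2 * (norm (g x))\<^sup>2)"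
    by (rule integral_mono[OF i2 i]) (rule square_norm_add_le)
  then show "(LINT x|M. (norm (f x + g x))\<^sup>2) \<le> 2 * (LINT x|M. (norm (f x))\<^sup>2) + 2 * (LINT x|M. (norm (g x))\<^sup>2)"
    using int by simp
qed

lemma integral_norm_weak_grad_cong:
  fixes G :: "'a::euclidean_space \<Rightarrow> 'a"
  assumes S: "open S" and G: "has_weak_grad S u G" "G \<in> borel_measurable (lebesgue_on S)"
  shows "(LINT x|lebesgue_on S. (norm (weak_grad S u x))\<^sup>2) = (LINT x|lebesgue_on S. (norm (G x))\<^sup>2)"
proof (rule integral_cong_AE)
  note ae = weak_grad_unique[OF S G(1)]
  then show "AE x in lebesgue_on S. (norm (weak_grad S u x))\<^sup>2 = (norm (G x))\<^sup>2" by eventually_elim simp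
  have "weak_grad S u \<in> borel_measurable (lebesgue_on S)"
    by (rule borel_measurable_lebesgue_on_AE[OF open_sets_lebesgue[OF S] G(2)]) (use ae in \<open>auto elim: eventually_mono\<close>)
  then show "(\<lambda>x. (norm (weak_grad S u x))\<^sup>2) \<in> borel_measurable (lebesgue_on S)" by measurable
  show "(\<lambda>x. (norm (G x))\<^sup>2) \<in> borel_measurable (lebesgue_on S)" using G(2) by measurable
qed

lemma sobolev_1_2_add:
  fixes u v :: "'a::euclidean_space \<Rightarrow> real"
  assumes S: "open S" and u: "u \<in> sobolev 1 2 S" and v: "v \<in> sobolev 1 2 S"
  shows "(\<lambda>x. u x + v x) \<in> sobolev 1 2 S"
    "h1_energy S (\<lambda>x. u x + v x) \<le> 2 * h1_energy S u + 2 * h1_energy S v"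
proof -
  note U = sobolev_1_2D[OF S u] and V = sobolev_1_2D[OF S v]
  note [measurable] = U(1,4) V(1,4)
  have g: "has_weak_grad S (\<lambda>x. u x + v x) (\<lambda>x. weak_grad S u x + weak_grad S v x)"
    by (rule has_weak_grad_add[OF S U(3) V(3)])
  have i: "integrable (lebesgue_on S) (\<lambda>x. (u x + v x)\<^sup>2)"
    "(LINT x|lebesgue_on S. (u x + v x)\<^sup>2) \<le> 2 * (LINT x|lebesgue_on S. (u x)\<^sup>2) + 2 * (LINT x|lebesgue_on S. (v x)\<^sup>2)"
    using integrable_square_norm_add[OF U(1) V(1)] U(2) V(2) by simp_all
  note j = integrable_square_norm_add[OF U(4) V(4) U(5) V(5)]
  show "(\<lambda>x. u x + v x) \<in> sobolev 1 2 S" by (rule sobolev_1_2I[OF _ i(1) g _ j(1)]) measurable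
  show "h1_energy S (\<lambda>x. u x + v x) \<le> 2 * h1_energy S u + 2 * h1_energy S v"
    using i(2) j(2) integral_norm_weak_grad_cong[OF S g] by (simp add: h1_energy_def)
qed

lemma sobolev_1_2_cmult:
  fixes u :: "'a::euclidean_space \<Rightarrow> real"
  assumes S: "open S" and u: "u \<in> sobolev 1 2 S"
  shows "(\<lambda>x. c * u x) \<in> sobolev 1 2 S"
    "h1_energy S (\<lambda>x. c * u x) = c\<^sup>2 * h1_energy S u"
proof -
  note U = sobolev_1_2D[OF S u]
  note [measurable] = U(1,4)
  note g = has_weak_grad_cmult[OF U(3), of c]
  show "(\<lambda>x. c * u x) \<in> sobolev 1 2 S"
    by (rule sobolev_1_2I[OF _ _ g]) (measurable, simp_all add: U power_mult_distrib)
  show "h1_energy S (\<lambda>x. c * u x) = c\<^sup>2 * h1_energy S u"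
    using integral_norm_weak_grad_cong[OF S g] by (simp add: h1_energy_def power_mult_distrib distrib_left)
qed

section \<open>Test functions and their closure\<close>

lemma test_function_grad:
  fixes \<phi> :: "'a::euclidean_space \<Rightarrow> real"
  assumes S: "open S" and \<phi>: "\<phi> \<in> test_functions S"
  defines "D \<equiv> (\<lambda>x. \<Sum>i\<in>Basis. frechet_derivative \<phi> (at x) i *\<^sub>R i)"
  shows "has_weak_grad S \<phi> D" "continuous_on UNIV D" "integrable lborel (\<lambda>x. (norm (D x))\<^sup>2)"
    "\<phi> \<in> sobolev 1 2 S"
    "(LINT x|lebesgue_on S. (norm (weak_grad S \<phi> x))\<^sup>2) = (LINT x|lborel. (norm (D x))\<^sup>2)"
proof -
  note sm = test_function_smooth[OF \<phi>]
  obtain C where C: "compact C" "C \<subseteq> S" "\<And>x. x \<notin> C \<Longrightarrow> \<phi> x = 0" using test_function_support[OF \<phi>] by metis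
  have D0: "D x = 0" if "x \<notin> C" for x
    unfolding D_def using frechet_derivative_outside_support[OF compact_imp_closed[OF C(1)] C(3) that] by simp
  have "C_k 1 \<phi>" using \<phi> unfolding test_functions_def by blast
  then show g: "has_weak_grad S \<phi> D" unfolding D_def by (rule has_weak_grad_C1[OF S])
  show cD: "continuous_on UNIV D" unfolding D_def by (intro continuous_intros sm)
  have S': "S \<in> sets lebesgue" by (rule open_sets_lebesgue[OF S])
  have cD2: "continuous_on UNIV (\<lambda>x. (norm (D x))\<^sup>2)" and c2: "continuous_on UNIV (\<lambda>x. (\<phi> x)\<^sup>2)"
    by (intro continuous_intros cD sm)+
  show "integrable lborel (\<lambda>x. (norm (D x))\<^sup>2)"
    by (rule integrable_lebesgue_compact_support[OF C(1) cD2]) (simp add: D0)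
  have iD: "integrable lebesgue (\<lambda>x. (norm (D x))\<^sup>2)"
    by (rule integrable_lebesgue_compact_support[OF C(1) cD2]) (simp add: D0)
  have i2: "integrable lebesgue (\<lambda>x. (\<phi> x)\<^sup>2)"
    by (rule integrable_lebesgue_compact_support[OF C(1) c2]) (simp add: C)
  have mD: "D \<in> borel_measurable (lebesgue_on S)"
    by (intro measurable_restrict_space1 measurable_completion) (simp add: cD borel_measurable_continuous_onI)
  have m: "\<phi> \<in> borel_measurable (lebesgue_on S)"
    by (intro measurable_restrict_space1 measurable_completion) (simp add: sm borel_measurable_continuous_onI)
  show "\<phi> \<in> sobolev 1 2 S"
  proof (rule sobolev_1_2I[OF m _ g mD])
    show "integrable (lebesgue_on S) (\<lambda>x. (\<phi> x)\<^sup>2)"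
      by (subst integrable_lebesgue_on_iff[OF S']) (use C i2 in auto)
    show "integrable (lebesgue_on S) (\<lambda>x. (norm (D x))\<^sup>2)"
      by (subst integrable_lebesgue_on_iff[OF S']) (use C D0 iD in auto)
  qed
  have "(LINT x|lebesgue_on S. (norm (D x))\<^sup>2) = (LINT x|lebesgue. (norm (D x))\<^sup>2)"
    by (rule integral_lebesgue_on_eq[OF S']) (use C D0 in auto)
  also have "\<dots> = (LINT x|lborel. (norm (D x))\<^sup>2)"
    by (rule integral_completion) (simp add: cD2 borel_measurable_continuous_onI)
  finally show "(LINT x|lebesgue_on S. (norm (weak_grad S \<phi> x))\<^sup>2) = (LINT x|lborel. (norm (D x))\<^sup>2)"
    using integral_norm_weak_grad_cong[OF S g mD] by simp
qed

lemma test_functions_add: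
  assumes "\<phi> \<in> test_functions S" "\<psi> \<in> test_functions S"
  shows "(\<lambda>x. \<phi> x + \<psi> x) \<in> test_functions S"
proof -
  obtain C where C: "compact C" "C \<subseteq> S" "\<And>x. x \<notin> C \<Longrightarrow> \<phi> x = 0" using test_function_support[OF assms(1)] by metis
  obtain D where D: "compact D" "D \<subseteq> S" "\<And>x. x \<notin> D \<Longrightarrow> \<psi> x = 0" using test_function_support[OF assms(2)] by metis
  show ?thesis
  proof (rule test_functionsI[of _ "C \<union> D"])
    show "C_k k (\<lambda>x. \<phi> x + \<psi> x)" for k using assms by (auto simp: test_functions_def intro: C_k_add)
    show "x \<in> C \<union> D" if "\<phi> x + \<psi> x \<noteq> 0" for x using that C(3)[of x] D(3)[of x] by fastforce
  qed (use C D in auto)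
qed

lemma test_functions_cmult:
  assumes "\<phi> \<in> test_functions S"
  shows "(\<lambda>x. c * \<phi> x) \<in> test_functions S"
proof -
  obtain C where C: "compact C" "C \<subseteq> S" "\<And>x. x \<notin> C \<Longrightarrow> \<phi> x = 0" using test_function_support[OF assms] by metis
  show ?thesis
  proof (rule test_functionsI[of _ C])
    show "C_k k (\<lambda>x. c * \<phi> x)" for k using assms by (auto simp: test_functions_def intro: C_k_mult C_k_const)
    show "x \<in> C" if "c * \<phi> x \<noteq> 0" for x using that C(3)[of x] by auto
  qed (use C in auto)
qed

lemma sobolev_1_2_diff:
  assumes "open S" "u \<in> sobolev 1 2 S" "v \<in> sobolev 1 2 S"
  shows "(\<lambda>x. u x - v x) \<in> sobolev 1 2 S"
  using sobolev_1_2_add(1)[OF assms(1,2) sobolev_1_2_cmult(1)[OF assms(1,3), of "-1"]] by simp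

lemma H10_iff:
  fixes u :: "'a::euclidean_space \<Rightarrow> real"
  assumes S: "open S"
  shows "u \<in> H10 S \<longleftrightarrow> u \<in> sobolev 1 2 S \<and>
    (\<exists>\<phi>. (\<forall>n. \<phi> n \<in> test_functions S) \<and> (\<lambda>n. h1_energy S (\<lambda>x. u x - \<phi> n x)) \<longlonglongrightarrow> 0)"
proof -
  have "(\<lambda>n. W1p_norm 2 S (\<lambda>x. u x - \<phi> n x)) \<longlonglongrightarrow> 0 \<longleftrightarrow> (\<lambda>n. h1_energy S (\<lambda>x. u x - \<phi> n x)) \<longlonglongrightarrow> 0"
    if u: "u \<in> sobolev 1 2 S" and \<phi>: "\<forall>n. \<phi> n \<in> test_functions S" for \<phi>
  proof -
    have eq: "W1p_norm 2 S (\<lambda>x. u x - \<phi> n x) = sqrt (h1_energy S (\<lambda>x. u x - \<phi> n x))" for n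
      by (rule W1p_norm_2[OF S sobolev_1_2_diff[OF S u test_function_grad(4)[OF S]]]) (simp add: \<phi>)
    show ?thesis
    proof
      assume "(\<lambda>n. W1p_norm 2 S (\<lambda>x. u x - \<phi> n x)) \<longlonglongrightarrow> 0"
      from tendsto_power[OF this, of 2] show "(\<lambda>n. h1_energy S (\<lambda>x. u x - \<phi> n x)) \<longlonglongrightarrow> 0"
        unfolding eq by (simp add: h1_energy_nonneg)
    next
      assume "(\<lambda>n. h1_energy S (\<lambda>x. u x - \<phi> n x)) \<longlonglongrightarrow> 0"
      from tendsto_real_sqrt[OF this] show "(\<lambda>n. W1p_norm 2 S (\<lambda>x. u x - \<phi> n x)) \<longlonglongrightarrow> 0"
        unfolding eq by simp
    qed
  qed
  then show ?thesis unfolding H10_def by blast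
qed

lemma H10_add:
  fixes u v :: "'a::euclidean_space \<Rightarrow> real"
  assumes S: "open S" and u: "u \<in> H10 S" and v: "v \<in> H10 S"
  shows "(\<lambda>x. u x + v x) \<in> H10 S"
proof -
  obtain \<phi> where \<phi>: "u \<in> sobolev 1 2 S" "\<And>n. \<phi> n \<in> test_functions S" "(\<lambda>n. h1_energy S (\<lambda>x. u x - \<phi> n x)) \<longlonglongrightarrow> 0"
    using u H10_iff[OF S] by blast
  obtain \<psi> where \<psi>: "v \<in> sobolev 1 2 S" "\<And>n. \<psi> n \<in> test_functions S" "(\<lambda>n. h1_energy S (\<lambda>x. v x - \<psi> n x)) \<longlonglongrightarrow> 0"
    using v H10_iff[OF S] by blast
  have "(\<lambda>n. h1_energy S (\<lambda>x. (u x + v x) - (\<phi> n x + \<psi> n x))) \<longlonglongrightarrow> 0"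
  proof (rule tendsto_sandwich[OF _ _ tendsto_const])
    show "\<forall>\<^sub>F n in sequentially. 0 \<le> h1_energy S (\<lambda>x. (u x + v x) - (\<phi> n x + \<psi> n x))"
      by (simp add: h1_energy_nonneg)
    have "h1_energy S (\<lambda>x. (u x + v x) - (\<phi> n x + \<psi> n x))
       \<le> 2 * h1_energy S (\<lambda>x. u x - \<phi> n x) + 2 * h1_energy S (\<lambda>x. v x - \<psi> n x)" for n
      using sobolev_1_2_add(2)[OF S sobolev_1_2_diff[OF S \<phi>(1) test_function_grad(4)[OF S \<phi>(2)]]
          sobolev_1_2_diff[OF S \<psi>(1) test_function_grad(4)[OF S \<psi>(2)]], of n n]
      by (simp add: algebra_simps)
    then show "\<forall>\<^sub>F n in sequentially. h1_energy S (\<lambda>x. (u x + v x) - (\<phi> n x + \<psi> n x))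
       \<le> 2 * h1_energy S (\<lambda>x. u x - \<phi> n x) + 2 * h1_energy S (\<lambda>x. v x - \<psi> n x)" by simp
    show "(\<lambda>n. 2 * h1_energy S (\<lambda>x. u x - \<phi> n x) + 2 * h1_energy S (\<lambda>x. v x - \<psi> n x)) \<longlonglongrightarrow> 0"
      using tendsto_add[OF tendsto_mult_left[OF \<phi>(3), of 2] tendsto_mult_left[OF \<psi>(3), of 2]] by simp
  qed
  then show ?thesis
    unfolding H10_iff[OF S] using sobolev_1_2_add(1)[OF S \<phi>(1) \<psi>(1)] test_functions_add[OF \<phi>(2) \<psi>(2)]
    by (intro conjI exI[of _ "\<lambda>n x. \<phi> n x + \<psi> n x"]) auto
qed

lemma H10_cmult:
  fixes u :: "'a::euclidean_space \<Rightarrow> real"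
  assumes S: "open S" and u: "u \<in> H10 S"
  shows "(\<lambda>x. c * u x) \<in> H10 S"
proof -
  obtain \<phi> where \<phi>: "u \<in> sobolev 1 2 S" "\<And>n. \<phi> n \<in> test_functions S" "(\<lambda>n. h1_energy S (\<lambda>x. u x - \<phi> n x)) \<longlonglongrightarrow> 0"
    using u H10_iff[OF S] by blast
  have "h1_energy S (\<lambda>x. c * u x - c * \<phi> n x) = c\<^sup>2 * h1_energy S (\<lambda>x. u x - \<phi> n x)" for n
    using sobolev_1_2_cmult(2)[OF S sobolev_1_2_diff[OF S \<phi>(1) test_function_grad(4)[OF S \<phi>(2)]], of c n]
    by (simp add: right_diff_distrib)
  then have "(\<lambda>n. h1_energy S (\<lambda>x. c * u x - c * \<phi> n x)) \<longlonglongrightarrow> 0"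
    using tendsto_mult_left[OF \<phi>(3), of "c\<^sup>2"] by simp
  then show ?thesis
    unfolding H10_iff[OF S] using sobolev_1_2_cmult(1)[OF S \<phi>(1)] test_functions_cmult[OF \<phi>(2)]
    by (intro conjI exI[of _ "\<lambda>n x. c * \<phi> n x"]) auto
qed

lemma H10_diff:
  assumes "open S" "u \<in> H10 S" "v \<in> H10 S"
  shows "(\<lambda>x. u x - v x) \<in> H10 S"
  using H10_add[OF assms(1,2) H10_cmult[OF assms(1,3), of "-1"]] by simp

section \<open>A Sobolev inequality in the plane\<close>

lemma Basis_real2: "(Basis :: (real^2) set) = {axis 1 1, axis 2 1}" "axis 1 1 \<noteq> (axis 2 1 :: real^2)"
  by (auto simp: Basis_vec_def UNIV_2 axis_eq_axis)

lemma axis_1_in_Basis: "axis i (1::real) \<in> Basis"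
  by (auto simp: Basis_vec_def)

text \<open>Both measures give every box the product of its side lengths, which determines Lebesgue
  measure. The identification makes Tonelli's theorem available on \<open>real^2\<close>.\<close>

lemma lborel_real2:
  "(lborel :: (real^2) measure) =
    distr (lborel \<Otimes>\<^sub>M lborel) borel (\<lambda>(s, t). s *\<^sub>R axis 1 1 + t *\<^sub>R axis 2 1)"
proof (rule lborel_eqI)
  let ?J = "\<lambda>(s, t). s *\<^sub>R axis 1 1 + t *\<^sub>R axis 2 1 :: real^2"
  fix l u :: "real^2" assume lu: "\<And>b. b \<in> Basis \<Longrightarrow> l \<bullet> b \<le> u \<bullet> b"
  have le: "l $ 1 \<le> u $ 1" "l $ 2 \<le> u $ 2"
    using lu[of "axis 1 1"] lu[of "axis 2 1"] by (simp_all add: Basis_real2 inner_axis)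
  have "?J -` box l u \<inter> space (lborel \<Otimes>\<^sub>M lborel) = {l $ 1<..<u $ 1} \<times> {l $ 2<..<u $ 2}"
    by (auto simp: mem_box_cart forall_2 axis_def space_pair_measure)
  moreover have "?J \<in> borel_measurable (lborel \<Otimes>\<^sub>M lborel)" by measurable
  ultimately have "emeasure (distr (lborel \<Otimes>\<^sub>M lborel) borel ?J) (box l u)
      = emeasure (lborel \<Otimes>\<^sub>M lborel) ({l $ 1<..<u $ 1} \<times> {l $ 2<..<u $ 2})"
    by (subst emeasure_distr) auto
  also have "\<dots> = ennreal ((u $ 1 - l $ 1) * (u $ 2 - l $ 2))"
    using le by (subst lborel.emeasure_pair_measure_Times) (auto simp: ennreal_mult)
  also have "\<dots> = ennreal (\<Prod>b\<in>Basis. (u - l) \<bullet> b)"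
    using Basis_real2(2) by (simp add: Basis_real2(1) inner_axis)
  finally show "emeasure (distr (lborel \<Otimes>\<^sub>M lborel) borel ?J) (box l u) = (\<Prod>b\<in>Basis. (u - l) \<bullet> b)" .
qed simp

lemma nn_integral_lborel_real2:
  assumes [measurable]: "f \<in> borel_measurable (borel :: (real^2) measure)"
  shows "(\<integral>\<^sup>+x. f x \<partial>lborel) = (\<integral>\<^sup>+s. \<integral>\<^sup>+t. f (s *\<^sub>R axis 1 1 + t *\<^sub>R axis 2 1) \<partial>lborel \<partial>lborel)"
    "(\<integral>\<^sup>+x. f x \<partial>lborel) = (\<integral>\<^sup>+t. \<integral>\<^sup>+s. f (s *\<^sub>R axis 1 1 + t *\<^sub>R axis 2 1) \<partial>lborel \<partial>lborel)"
proof -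
  let ?g = "\<lambda>(s, t). f (s *\<^sub>R axis 1 1 + t *\<^sub>R axis 2 1)"
  have m: "?g \<in> borel_measurable (lborel \<Otimes>\<^sub>M lborel)" by measurable
  have "(\<integral>\<^sup>+x. f x \<partial>lborel) = (\<integral>\<^sup>+p. ?g p \<partial>(lborel \<Otimes>\<^sub>M lborel))"
    by (subst lborel_real2, subst nn_integral_distr) (auto simp: case_prod_beta')
  also have "\<dots> = (\<integral>\<^sup>+s. \<integral>\<^sup>+t. f (s *\<^sub>R axis 1 1 + t *\<^sub>R axis 2 1) \<partial>lborel \<partial>lborel)"
    by (subst lborel.nn_integral_fst[symmetric]) (use m in auto)
  finally show fst: "(\<integral>\<^sup>+x. f x \<partial>lborel) = (\<integral>\<^sup>+s. \<integral>\<^sup>+t. f (s *\<^sub>R axis 1 1 + t *\<^sub>R axis 2 1) \<partial>lborel \<partial>lborel)" .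
  show "(\<integral>\<^sup>+x. f x \<partial>lborel) = (\<integral>\<^sup>+t. \<integral>\<^sup>+s. f (s *\<^sub>R axis 1 1 + t *\<^sub>R axis 2 1) \<partial>lborel \<partial>lborel)"
    unfolding fst by (rule lborel_pair.Fubini'[symmetric]) (use m in simp)
qed

text \<open>Integrate \<open>f'\<close> from a point to the left of the support, where
  \<open>f\<close> is 0, up to \<open>x\<close>.\<close>

lemma abs_le_nn_integral_derivative:
  fixes f f' :: "real \<Rightarrow> real"
  assumes f: "\<And>x. (f has_real_derivative f' x) (at x)" and cont: "continuous_on UNIV f'"
    and zero: "\<And>x. R < \<bar>x\<bar> \<Longrightarrow> f x = 0"
  shows "ennreal \<bar>f x\<bar> \<le> (\<integral>\<^sup>+s. ennreal \<bar>f' s\<bar> \<partial>lborel)"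
proof -
  \<comment> \<open>Chosen so that both \<open>a \<le> x\<close> and
    \<open>R < \<bar>a\<bar>\<close> hold, whatever the signs of \<open>R\<close> and
    \<open>x\<close>.\<close>
  define a where "a = - (\<bar>R\<bar> + \<bar>x\<bar> + 1)"
  have a: "a \<le> x" "f a = 0" using zero[of a] by (auto simp: a_def)
  have c: "continuous_on {a..x} f'" using cont by (rule continuous_on_subset) simp
  have eq: "(LINT s|lborel. indicator {a..x} s *\<^sub>R f' s) = f x - f a"
    by (rule integral_FTC_atLeastAtMost[OF a(1) _ c])
      (use f in \<open>auto simp: has_real_derivative_iff_has_vector_derivative[symmetric] intro: has_field_derivative_at_within\<close>)
  have int: "integrable lborel (\<lambda>s. indicator {a..x} s *\<^sub>R f' s)"
    by (rule borel_integrable_compact[OF compact_Icc c])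
  have "ennreal \<bar>f x\<bar> \<le> (\<integral>\<^sup>+s. norm (indicator {a..x} s *\<^sub>R f' s) \<partial>lborel)"
    using integral_norm_bound_ennreal[OF int] unfolding eq a(2) by simp
  also have "\<dots> \<le> (\<integral>\<^sup>+s. ennreal \<bar>f' s\<bar> \<partial>lborel)"
    by (intro nn_integral_mono) (auto simp: indicator_def)
  finally show ?thesis .
qed

text \<open>At a point \<open>(s, t)\<close>, bound one factor \<open>\<bar>\<psi>\<bar>\<close> by \<open>A(t) = \<integral>\<bar>\<partial>\<^sub>1\<psi>(\<cdot>, t)\<bar>\<close> and the other by
  \<open>B(s) = \<integral>\<bar>\<partial>\<^sub>2\<psi>(s, \<cdot>)\<bar>\<close>.\<close>

lemma Gagliardo_nn:
  fixes \<psi> :: "real^2 \<Rightarrow> real"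
  assumes \<psi>: "C_k 1 \<psi>" and C: "compact C" "\<And>x. x \<notin> C \<Longrightarrow> \<psi> x = 0"
  shows "(\<integral>\<^sup>+x. ennreal ((\<psi> x)\<^sup>2) \<partial>lborel) \<le>
    (\<integral>\<^sup>+x. ennreal \<bar>frechet_derivative \<psi> (at x) (axis 1 1)\<bar> \<partial>lborel) *
    (\<integral>\<^sup>+x. ennreal \<bar>frechet_derivative \<psi> (at x) (axis 2 1)\<bar> \<partial>lborel)"
proof -
  define D where "D i x = frechet_derivative \<psi> (at x) (axis i 1)" for i :: 2 and x
  define J :: "real \<Rightarrow> real \<Rightarrow> real^2" where "J s t = s *\<^sub>R axis 1 1 + t *\<^sub>R axis 2 1" for s t
  have d: "\<psi> differentiable_on UNIV" using \<psi> by simp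
  have cD: "continuous_on UNIV (D i)" for i
    using \<psi> by (simp add: D_def axis_1_in_Basis)
  have [measurable]: "D i \<in> borel_measurable borel" for i using cD by (rule borel_measurable_continuous_onI)
  have [measurable]: "\<psi> \<in> borel_measurable borel"
    using differentiable_imp_continuous_on[OF d] by (rule borel_measurable_continuous_onI)
  have [measurable]: "(\<lambda>p. J (fst p) (snd p)) \<in> borel_measurable (borel \<Otimes>\<^sub>M borel)"
    unfolding J_def by measurable
  have [measurable]: "J s \<in> borel_measurable borel" "(\<lambda>s. J s t) \<in> borel_measurable borel" for s t
    unfolding J_def by measurable
  obtain R where R: "\<And>x. x \<in> C \<Longrightarrow> norm x \<le> R"
    using compact_imp_bounded[OF C(1)] by (auto simp: bounded_iff)
  have comp: "J s t $ 1 = s" "J s t $ 2 = t" for s t :: real by (simp_all add: axis_def J_def)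
  have far: "\<psi> (J s t) = 0" if "R < \<bar>s\<bar> \<or> R < \<bar>t\<bar>" for s t
    using R[of "J s t"] C(2)[of "J s t"] that component_le_norm_cart[of "J s t" 1] component_le_norm_cart[of "J s t" 2]
    by (force simp: comp)
  define A where "A t = (\<integral>\<^sup>+s. ennreal \<bar>D 1 (J s t)\<bar> \<partial>lborel)" for t
  define B where "B s = (\<integral>\<^sup>+t. ennreal \<bar>D 2 (J s t)\<bar> \<partial>lborel)" for s
  have leA: "ennreal \<bar>\<psi> (J s t)\<bar> \<le> A t" for s t
    unfolding A_def
  proof (rule abs_le_nn_integral_derivative[of "\<lambda>s. \<psi> (J s t)"])
    show "((\<lambda>s. \<psi> (J s t)) has_real_derivative D 1 (J s t)) (at s)" for s
      using partial_along_line[OF d, of "t *\<^sub>R axis 2 1" "axis 1 1" s] by (simp add: D_def J_def add.commute)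
    show "continuous_on UNIV (\<lambda>s. D 1 (J s t))"
      unfolding J_def by (intro continuous_on_compose2[OF cD] continuous_intros) auto
  qed (use far in blast)
  have leB: "ennreal \<bar>\<psi> (J s t)\<bar> \<le> B s" for s t
    unfolding B_def
  proof (rule abs_le_nn_integral_derivative[of "\<lambda>t. \<psi> (J s t)"])
    show "((\<lambda>t. \<psi> (J s t)) has_real_derivative D 2 (J s t)) (at t)" for t
      using partial_along_line[OF d, of "s *\<^sub>R axis 1 1" "axis 2 1" t] by (simp add: D_def J_def)
    show "continuous_on UNIV (\<lambda>t. D 2 (J s t))"
      unfolding J_def by (intro continuous_on_compose2[OF cD] continuous_intros) auto
  qed (use far in blast)
  have le: "ennreal ((\<psi> (J s t))\<^sup>2) \<le> B s * A t" for s t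
  proof -
    have "ennreal \<bar>\<psi> (J s t)\<bar> * ennreal \<bar>\<psi> (J s t)\<bar> \<le> B s * A t" using leA leB by (intro mult_mono) auto
    then show ?thesis by (simp add: ennreal_mult[symmetric] power2_eq_square abs_mult[symmetric])
  qed
  have mA: "A \<in> borel_measurable borel" and mB: "B \<in> borel_measurable borel"
    unfolding A_def B_def J_def by measurable
  note [measurable] = mA mB
  have "(\<integral>\<^sup>+x. ennreal ((\<psi> x)\<^sup>2) \<partial>lborel) = (\<integral>\<^sup>+s. \<integral>\<^sup>+t. ennreal ((\<psi> (J s t))\<^sup>2) \<partial>lborel \<partial>lborel)"
    unfolding J_def by (rule nn_integral_lborel_real2) measurable
  also have "\<dots> \<le> (\<integral>\<^sup>+s. \<integral>\<^sup>+t. B s * A t \<partial>lborel \<partial>lborel)"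
    by (intro nn_integral_mono le)
  also have "\<dots> = (\<integral>\<^sup>+t. A t \<partial>lborel) * (\<integral>\<^sup>+s. B s \<partial>lborel)"
    by (simp add: nn_integral_cmult nn_integral_multc mult.commute)
  \<comment> \<open>Each factor turns back into a plane integral, but with opposite orders of
    integration; this is what the two forms of \<open>nn_integral_lborel_real2\<close> are
    for.\<close>
  also have "(\<integral>\<^sup>+t. A t \<partial>lborel) = (\<integral>\<^sup>+x. ennreal \<bar>D 1 x\<bar> \<partial>lborel)"
    unfolding A_def J_def by (rule nn_integral_lborel_real2(2)[symmetric]) measurable
  also have "(\<integral>\<^sup>+s. B s \<partial>lborel) = (\<integral>\<^sup>+x. ennreal \<bar>D 2 x\<bar> \<partial>lborel)"
    unfolding B_def J_def by (rule nn_integral_lborel_real2(1)[symmetric]) measurable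
  finally show ?thesis by (simp add: D_def)
qed

lemma Gagliardo:
  fixes \<psi> :: "real^2 \<Rightarrow> real"
  assumes \<psi>: "C_k 1 \<psi>" and C: "compact C" "\<And>x. x \<notin> C \<Longrightarrow> \<psi> x = 0"
  shows "(LINT x|lborel. (\<psi> x)\<^sup>2) \<le>
    (LINT x|lborel. \<bar>frechet_derivative \<psi> (at x) (axis 1 1)\<bar>) *
    (LINT x|lborel. \<bar>frechet_derivative \<psi> (at x) (axis 2 1)\<bar>)"
proof -
  have d: "\<psi> differentiable_on UNIV" using \<psi> by simp
  have cD: "continuous_on UNIV (\<lambda>x. \<bar>frechet_derivative \<psi> (at x) (axis i 1)\<bar>)" for i :: 2
    using \<psi> by (intro continuous_intros) (simp add: axis_1_in_Basis)
  have D0: "\<bar>frechet_derivative \<psi> (at x) i\<bar> = 0" if "x \<notin> C" for x i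
    using frechet_derivative_outside_support[OF compact_imp_closed[OF C(1)] C(2) that] by simp
  have c2: "continuous_on UNIV (\<lambda>x. (\<psi> x)\<^sup>2)"
    by (intro continuous_intros differentiable_imp_continuous_on[OF d])
  have i1: "integrable lborel (\<lambda>x. \<bar>frechet_derivative \<psi> (at x) (axis i 1)\<bar>)" for i :: 2
    by (rule integrable_lebesgue_compact_support[OF C(1) cD D0])
  have i2: "integrable lborel (\<lambda>x. (\<psi> x)\<^sup>2)"
    by (rule integrable_lebesgue_compact_support[OF C(1) c2]) (simp add: C(2))
  have "ennreal (LINT x|lborel. (\<psi> x)\<^sup>2) \<le>
    ennreal (LINT x|lborel. \<bar>frechet_derivative \<psi> (at x) (axis 1 1)\<bar>) *
    ennreal (LINT x|lborel. \<bar>frechet_derivative \<psi> (at x) (axis 2 1)\<bar>)"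
    using Gagliardo_nn[OF assms] i1 i2 by (simp add: nn_integral_eq_integral)
  then show ?thesis by (simp add: ennreal_mult[symmetric] ennreal_le_iff)
qed

text \<open>Integrability of the product comes from |f g| <= f^2 + g^2. The estimate is kept in
  squared form so that no square roots enter the later computations.\<close>

lemma Cauchy_Schwarz_integral:
  fixes f g :: "'a \<Rightarrow> real"
  assumes [measurable]: "f \<in> borel_measurable M" "g \<in> borel_measurable M"
    and int: "integrable M (\<lambda>x. (f x)\<^sup>2)" "integrable M (\<lambda>x. (g x)\<^sup>2)"
  shows "integrable M (\<lambda>x. f x * g x)"
    "(LINT x|M. \<bar>f x * g x\<bar>)\<^sup>2 \<le> (LINT x|M. (f x)\<^sup>2) * (LINT x|M. (g x)\<^sup>2)"
proof -
  show i: "integrable M (\<lambda>x. f x * g x)"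
  proof (rule Bochner_Integration.integrable_bound)
    show "integrable M (\<lambda>x. (f x)\<^sup>2 + (g x)\<^sup>2)" using int by simp
    have "\<bar>f x * g x\<bar> \<le> (f x)\<^sup>2 + (g x)\<^sup>2" for x
    proof -
      have "2 * \<bar>f x\<bar> * \<bar>g x\<bar> \<le> (f x)\<^sup>2 + (g x)\<^sup>2" "0 \<le> \<bar>f x\<bar> * \<bar>g x\<bar>"
        using sum_squares_bound[of "\<bar>f x\<bar>" "\<bar>g x\<bar>"] by simp_all
      then show ?thesis unfolding abs_mult by linarith
    qed
    then show "AE x in M. norm (f x * g x) \<le> norm ((f x)\<^sup>2 + (g x)\<^sup>2)" by simp
  qed measurable
  have "(\<integral>\<^sup>+x. ennreal \<bar>f x\<bar> * ennreal \<bar>g x\<bar> \<partial>M)\<^sup>2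
      \<le> (\<integral>\<^sup>+x. (ennreal \<bar>f x\<bar>)\<^sup>2 \<partial>M) * (\<integral>\<^sup>+x. (ennreal \<bar>g x\<bar>)\<^sup>2 \<partial>M)"
    by (rule Cauchy_Schwarz_nn_integral) measurable
  then have "(ennreal (LINT x|M. \<bar>f x * g x\<bar>))\<^sup>2 \<le> ennreal (LINT x|M. (f x)\<^sup>2) * ennreal (LINT x|M. (g x)\<^sup>2)"
    using int integrable_abs[OF i]
    by (simp add: ennreal_mult[symmetric] ennreal_power abs_mult[symmetric] nn_integral_eq_integral)
  then show "(LINT x|M. \<bar>f x * g x\<bar>)\<^sup>2 \<le> (LINT x|M. (f x)\<^sup>2) * (LINT x|M. (g x)\<^sup>2)"
    by (simp add: ennreal_mult[symmetric] ennreal_power ennreal_le_iff integral_nonneg_AE)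
qed

text \<open>Gagliardo's inequality for \<open>\<phi>\<close> squared bounds the fourth powers by a
  product of two integrals of |\<phi> D_i \<phi>|, the factor 4 stemming from the two derivatives 2
  \<phi> D_i \<phi>. Cauchy-Schwarz splits each of these, and the remaining L^2 norm of
  \<open>\<phi>\<close> is traded for area times energy by Gagliardo's inequality for
  \<open>\<phi>\<close> itself.\<close>

lemma Ladyzhenskaya_test_function:
  fixes \<phi> :: "real^2 \<Rightarrow> real"
  assumes S: "open S" "bounded S" and \<phi>: "\<phi> \<in> test_functions S"
  defines "N \<equiv> (LINT x|lebesgue_on S. (norm (weak_grad S \<phi> x))\<^sup>2)"
  shows "(LINT x|lborel. \<phi> x ^ 4) \<le> 4 * measure lborel S * N\<^sup>2"
proof -
  define D where "D i x = frechet_derivative \<phi> (at x) (axis i 1)" for i :: 2 and x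
  define m where "m = measure lborel S"
  obtain C where C: "compact C" "C \<subseteq> S" "\<And>x. x \<notin> C \<Longrightarrow> \<phi> x = 0" using test_function_support[OF \<phi>] by metis
  note sm = test_function_smooth[OF \<phi>]
  have cD: "continuous_on UNIV (D i)" for i unfolding D_def by (rule sm(3)) (simp add: axis_1_in_Basis)
  have [measurable]: "D i \<in> borel_measurable borel" for i using cD by (rule borel_measurable_continuous_onI)
  have [measurable]: "\<phi> \<in> borel_measurable borel" using sm(2) by (rule borel_measurable_continuous_onI)
  have D0: "D i x = 0" if "x \<notin> C" for x i
    unfolding D_def using frechet_derivative_outside_support[OF compact_imp_closed[OF C(1)] C(3) that] .
  have iD2: "integrable lborel (\<lambda>x. (D i x)\<^sup>2)" for i
    by (rule integrable_lebesgue_compact_support[OF C(1)]) (auto simp: D0 intro!: continuous_intros cD)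
  have iphi2: "integrable lborel (\<lambda>x. (\<phi> x)\<^sup>2)"
    by (rule integrable_lebesgue_compact_support[OF C(1)]) (auto simp: C intro!: continuous_intros sm)
  have N0: "0 \<le> N" by (simp add: N_def)
  have m0: "0 \<le> m" by (simp add: m_def)
  have DN: "(LINT x|lborel. (D i x)\<^sup>2) \<le> N" for i
  proof -
    have "N = (LINT x|lborel. (norm (\<Sum>i\<in>Basis. frechet_derivative \<phi> (at x) i *\<^sub>R i))\<^sup>2)"
      unfolding N_def by (rule test_function_grad(5)[OF S(1) \<phi>])
    also have "\<dots> = (LINT x|lborel. (D 1 x)\<^sup>2 + (D 2 x)\<^sup>2)"
      unfolding norm_square_eq_sum_Basis
      using Basis_real2(2) by (simp add: Basis_real2(1) D_def inner_axis_axis inner_add_left)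
    also have "\<dots> = (LINT x|lborel. (D 1 x)\<^sup>2) + (LINT x|lborel. (D 2 x)\<^sup>2)"
      using iD2 by simp
    finally show ?thesis using exhaust_2[of i] by auto
  qed
  have mS: "emeasure lborel S < \<infinity>" by (rule emeasure_bounded_finite[OF S(2)])
  have sq: "(indicator S x :: real)\<^sup>2 = indicator S x" for x by (simp add: indicator_def)
  have iS: "integrable lborel (\<lambda>x. (indicator S x :: real)\<^sup>2)"
    unfolding sq using mS S(1) by (intro integrable_real_indicator) auto
  have mS2: "(LINT x|lborel. (indicator S x :: real)\<^sup>2) = m"
    unfolding sq using S(1) by (simp add: m_def)
  have D1: "(LINT x|lborel. \<bar>D i x\<bar>)\<^sup>2 \<le> m * N" for i
  proof -
    \<comment> \<open>Inserting the indicator of \<open>S\<close> changes nothing, as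
      \<open>D i\<close> vanishes outside \<open>S\<close>, but lets Cauchy-Schwarz produce the area
      \<open>m\<close>.\<close>
    have "(LINT x|lborel. \<bar>D i x\<bar>) = (LINT x|lborel. \<bar>indicator S x * D i x\<bar>)"
      by (rule Bochner_Integration.integral_cong) (use C D0 in \<open>auto simp: indicator_def\<close>)
    moreover have "(LINT x|lborel. \<bar>indicator S x * D i x\<bar>)\<^sup>2 \<le> m * (LINT x|lborel. (D i x)\<^sup>2)"
      using Cauchy_Schwarz_integral(2)[OF _ _ iS iD2, of i] S(1) by (simp add: mS2)
    ultimately show ?thesis using mult_left_mono[OF DN[of i] m0] by simp
  qed
  \<comment> \<open>A Poincare inequality, whose constant is the area of \<open>S\<close>.\<close>
  have phi2: "(LINT x|lborel. (\<phi> x)\<^sup>2) \<le> m * N"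
  proof -
    have "C_k 1 \<phi>" using \<phi> unfolding test_functions_def by blast
    from Gagliardo[OF this C(1) C(3)]
    have le: "(LINT x|lborel. (\<phi> x)\<^sup>2) \<le> (LINT x|lborel. \<bar>D 1 x\<bar>) * (LINT x|lborel. \<bar>D 2 x\<bar>)"
      by (simp add: D_def)
    have "2 * (LINT x|lborel. \<bar>D 1 x\<bar>) * (LINT x|lborel. \<bar>D 2 x\<bar>)
        \<le> (LINT x|lborel. \<bar>D 1 x\<bar>)\<^sup>2 + (LINT x|lborel. \<bar>D 2 x\<bar>)\<^sup>2"
      by (rule sum_squares_bound)
    with le show ?thesis using D1[of 1] D1[of 2] by linarith
  qed
  have phiD: "(LINT x|lborel. \<bar>\<phi> x * D i x\<bar>)\<^sup>2 \<le> m * N\<^sup>2" for i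
  proof -
    have "(LINT x|lborel. \<bar>\<phi> x * D i x\<bar>)\<^sup>2 \<le> (LINT x|lborel. (\<phi> x)\<^sup>2) * (LINT x|lborel. (D i x)\<^sup>2)"
      by (rule Cauchy_Schwarz_integral(2)[OF _ _ iphi2 iD2]) measurable
    also have "\<dots> \<le> (m * N) * N"
      by (intro mult_mono phi2 DN) (simp_all add: m0 N0)
    finally show ?thesis by (simp add: power2_eq_square)
  qed
  have D2: "frechet_derivative (\<lambda>x. \<phi> x * \<phi> x) (at x) (axis i 1) = 2 * (\<phi> x * D i x)" for x and i :: 2
  proof -
    have "frechet_derivative (\<lambda>x. \<phi> x * \<phi> x) (at x) (axis i 1) = \<phi> x * D i x + D i x * \<phi> x"
      unfolding D_def by (rule frechet_derivative_eqI, rule has_derivative_mult)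
        (use sm(1) in \<open>auto intro: has_derivative_frechet\<close>)
    then show ?thesis by simp
  qed
  have "C_k 1 (\<lambda>x. \<phi> x * \<phi> x)" using \<phi> unfolding test_functions_def by (blast intro: C_k_mult)
  from Gagliardo[OF this C(1)]
  have "(LINT x|lborel. (\<phi> x * \<phi> x)\<^sup>2) \<le>
      (LINT x|lborel. \<bar>2 * (\<phi> x * D 1 x)\<bar>) * (LINT x|lborel. \<bar>2 * (\<phi> x * D 2 x)\<bar>)"
    using C(3) by (simp add: D2)
  moreover have "(\<phi> x * \<phi> x)\<^sup>2 = \<phi> x ^ 4" for x by (simp add: power2_eq_square power4_eq_xxxx)
  moreover have "\<bar>2 * (\<phi> x * D i x)\<bar> = 2 * \<bar>\<phi> x * D i x\<bar>" for x i by (simp add: abs_mult)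
  ultimately have "(LINT x|lborel. \<phi> x ^ 4) \<le>
      4 * ((LINT x|lborel. \<bar>\<phi> x * D 1 x\<bar>) * (LINT x|lborel. \<bar>\<phi> x * D 2 x\<bar>))"
    by simp
  \<comment> \<open>The product is replaced by half the sum of the squares, since
    \<open>phiD\<close> bounds squares.\<close>
  moreover have "2 * ((LINT x|lborel. \<bar>\<phi> x * D 1 x\<bar>) * (LINT x|lborel. \<bar>\<phi> x * D 2 x\<bar>)) \<le> 2 * (m * N\<^sup>2)"
    using sum_squares_bound[of "LINT x|lborel. \<bar>\<phi> x * D 1 x\<bar>" "LINT x|lborel. \<bar>\<phi> x * D 2 x\<bar>"] phiD[of 1] phiD[of 2]
    by (simp add: mult.assoc)
  ultimately show ?thesis unfolding m_def by linarith
qed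

text \<open>Approximating test functions converge in H^1, hence a.e. along a subsequence.
  Convergence of the fourth powers in the mean is not yet known, so Fatou's lemma provides
  integrability and the bound at once. The constant 4 grows to 16 because the energy of the
  approximants is bounded only by 2 \<open>G\<close> plus a null sequence, and this enters
  squared.\<close>

lemma H10_integral_power4:
  fixes u :: "real^2 \<Rightarrow> real"
  assumes S: "open S" "bounded S" and u: "u \<in> H10 S"
  defines "G \<equiv> (LINT x|lebesgue_on S. (norm (weak_grad S u x))\<^sup>2)"
  shows "integrable (lebesgue_on S) (\<lambda>x. u x ^ 4)"
    "(LINT x|lebesgue_on S. u x ^ 4) \<le> 16 * measure lborel S * G\<^sup>2"
proof -
  define m where "m = measure lborel S"
  let ?M = "lebesgue_on S"
  obtain \<phi> where u1: "u \<in> sobolev 1 2 S" and \<phi>: "\<And>n. \<phi> n \<in> test_functions S"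
    and lim: "(\<lambda>n. h1_energy S (\<lambda>x. u x - \<phi> n x)) \<longlonglongrightarrow> 0"
    using u H10_iff[OF S(1)] by blast
  define E where "E n = h1_energy S (\<lambda>x. u x - \<phi> n x)" for n
  note d = sobolev_1_2_diff[OF S(1) u1 test_function_grad(4)[OF S(1) \<phi>]]
  note d1 = sobolev_1_2D[OF S(1) d] and U = sobolev_1_2D[OF S(1) u1]
  note P = sobolev_1_2D[OF S(1) test_function_grad(4)[OF S(1) \<phi>]]
  note [measurable] = U(1) P(1)
  have "(\<lambda>n. LINT x|?M. norm ((u x - \<phi> n x)\<^sup>2)) \<longlonglongrightarrow> 0"
  proof (rule tendsto_sandwich[OF _ _ tendsto_const])
    show "(\<lambda>n. E n) \<longlonglongrightarrow> 0" unfolding E_def by (rule lim)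
  qed (simp_all add: E_def h1_energy_def)
  from tendsto_L1_AE_subseq[OF d1(2) this] obtain r where r: "strict_mono r"
    and ae: "AE x in ?M. (\<lambda>n. (u x - \<phi> (r n) x)\<^sup>2) \<longlonglongrightarrow> 0" by auto
  \<comment> \<open>The gradient of \<open>\<phi> n\<close> is the gradient of \<open>u\<close>
    minus that of \<open>u - \<phi> n\<close>; the latter has energy at most
    \<open>E n\<close>.\<close>
  have phi4: "(\<integral>\<^sup>+x. ennreal (\<phi> n x ^ 4) \<partial>?M) \<le> ennreal (4 * m * (2 * G + 2 * E n)\<^sup>2)" for n
  proof -
    define N where "N = (LINT x|?M. (norm (weak_grad S (\<phi> n) x))\<^sup>2)"
    have g: "has_weak_grad S (\<phi> n) (\<lambda>x. weak_grad S u x - weak_grad S (\<lambda>x. u x - \<phi> n x) x)"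
      using has_weak_grad_diff[OF S(1) U(3) d1(3)] by simp
    have "N = (LINT x|?M. (norm (weak_grad S u x + - weak_grad S (\<lambda>x. u x - \<phi> n x) x))\<^sup>2)"
      unfolding N_def using integral_norm_weak_grad_cong[OF S(1) g] U(4) d1(4) by simp
    also have "\<dots> \<le> 2 * G + 2 * (LINT x|?M. (norm (weak_grad S (\<lambda>x. u x - \<phi> n x) x))\<^sup>2)"
      using integrable_square_norm_add(2)[OF U(4) borel_measurable_uminus[OF d1(4)] U(5), of n] d1(5)[of n]
      by (simp add: G_def)
    also have "\<dots> \<le> 2 * G + 2 * E n" by (simp add: E_def h1_energy_def)
    finally have N: "N \<le> 2 * G + 2 * E n" .
    have "0 \<le> N" by (simp add: N_def)
    obtain C where C: "compact C" "C \<subseteq> S" "\<And>x. x \<notin> C \<Longrightarrow> \<phi> n x = 0" using test_function_support[OF \<phi>] by metis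
    have c4: "continuous_on UNIV (\<lambda>x. \<phi> n x ^ 4)" by (intro continuous_intros test_function_smooth[OF \<phi>])
    have i: "integrable lborel (\<lambda>x. \<phi> n x ^ 4)" "integrable lebesgue (\<lambda>x. \<phi> n x ^ 4)"
      by (rule integrable_lebesgue_compact_support[OF C(1) c4], simp add: C)+
    have S': "S \<in> sets lebesgue" by (rule open_sets_lebesgue[OF S(1)])
    have i': "integrable ?M (\<lambda>x. \<phi> n x ^ 4)"
      by (subst integrable_lebesgue_on_iff[OF S']) (use C i in auto)
    have "(LINT x|?M. \<phi> n x ^ 4) = (LINT x|lebesgue. \<phi> n x ^ 4)"
      by (rule integral_lebesgue_on_eq[OF S']) (use C in auto)
    also have "\<dots> = (LINT x|lborel. \<phi> n x ^ 4)"
      by (rule integral_completion) (simp add: c4 borel_measurable_continuous_onI)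
    also have "\<dots> \<le> 4 * m * N\<^sup>2"
      unfolding m_def N_def by (rule Ladyzhenskaya_test_function[OF S \<phi>])
    also have "\<dots> \<le> 4 * m * (2 * G + 2 * E n)\<^sup>2"
      using N \<open>0 \<le> N\<close> by (intro mult_left_mono power_mono) (simp_all add: m_def)
    finally show ?thesis using i' by (simp add: nn_integral_eq_integral ennreal_leI)
  qed
  have "(\<integral>\<^sup>+x. ennreal (u x ^ 4) \<partial>?M) = (\<integral>\<^sup>+x. liminf (\<lambda>n. ennreal (\<phi> (r n) x ^ 4)) \<partial>?M)"
  proof (rule nn_integral_cong_AE)
    show "AE x in ?M. ennreal (u x ^ 4) = liminf (\<lambda>n. ennreal (\<phi> (r n) x ^ 4))"
      using ae
    proof eventually_elim
      case (elim x)
      have "(\<lambda>n. \<bar>u x - \<phi> (r n) x\<bar>) \<longlonglongrightarrow> 0" using tendsto_real_sqrt[OF elim] by simp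
      then have "(\<lambda>n. u x - (u x - \<phi> (r n) x)) \<longlonglongrightarrow> u x - 0"
        by (intro tendsto_diff tendsto_const) (simp add: tendsto_rabs_zero_iff)
      then have "(\<lambda>n. ennreal (\<phi> (r n) x ^ 4)) \<longlonglongrightarrow> ennreal (u x ^ 4)"
        by (intro tendsto_ennrealI tendsto_power) simp
      from lim_imp_Liminf[OF trivial_limit_sequentially this] show ?case by (rule sym)
    qed
  qed
  \<comment> \<open>Fatou's lemma.\<close>
  also have "\<dots> \<le> liminf (\<lambda>n. \<integral>\<^sup>+x. ennreal (\<phi> (r n) x ^ 4) \<partial>?M)"
    by (rule nn_integral_liminf) measurable
  also have "\<dots> \<le> liminf (\<lambda>n. ennreal (4 * m * (2 * G + 2 * E (r n))\<^sup>2))"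
    by (rule Liminf_mono) (simp add: phi4)
  also have "\<dots> = ennreal (4 * m * (2 * G + 2 * 0)\<^sup>2)"
  proof (rule lim_imp_Liminf)
    have "(\<lambda>n. E (r n)) \<longlonglongrightarrow> 0"
      using LIMSEQ_subseq_LIMSEQ[OF lim r] unfolding E_def o_def .
    then show "(\<lambda>n. ennreal (4 * m * (2 * G + 2 * E (r n))\<^sup>2)) \<longlonglongrightarrow> ennreal (4 * m * (2 * G + 2 * 0)\<^sup>2)"
      by (intro tendsto_ennrealI tendsto_intros)
  qed simp
  finally have le: "(\<integral>\<^sup>+x. ennreal (u x ^ 4) \<partial>?M) \<le> ennreal (16 * m * G\<^sup>2)"
    by (simp add: power_mult_distrib mult.assoc)
  have "(\<lambda>x. u x ^ 4) \<in> borel_measurable ?M" by measurable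
  then show i: "integrable ?M (\<lambda>x. u x ^ 4)"
    by (rule integrableI_nonneg) (use le in \<open>auto intro: le_less_trans\<close>)
  have "ennreal (LINT x|?M. u x ^ 4) \<le> ennreal (16 * m * G\<^sup>2)"
    using le i by (simp add: nn_integral_eq_integral)
  then show "(LINT x|?M. u x ^ 4) \<le> 16 * measure lborel S * G\<^sup>2"
    by (simp add: m_def ennreal_le_iff)
qed

section \<open>Lipschitz continuity from a bounded weak derivative\<close>

text \<open>For an antiderivative \<open>H\<close> of a bump at the origin, test with \<open>\<phi>(t) = H(t - x) - H(t - y)\<close>: the
  derivative of \<open>\<phi>\<close> concentrates at \<open>x\<close> and \<open>y\<close>, and \<open>\<phi>\<close> is supported near the interval between them.\<close>

lemma weak_derivative_bounded_imp_Lipschitz: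
  fixes b g :: "real \<Rightarrow> real"
  assumes b: "continuous_on UNIV b" and g: "has_weak_partial UNIV 1 b g"
    and L: "AE x in lebesgue. \<bar>g x\<bar> \<le> L"
  shows "\<bar>b x - b y\<bar> \<le> L * \<bar>x - y\<bar>"
proof -
  \<comment> \<open>The condition does not depend on the point, so it holds everywhere or nowhere;
    holding a.e., it holds.\<close>
  have L0: "0 \<le> L"
  proof -
    have "AE x in lebesgue. x \<in> {x :: real. 0 \<le> L}"
      using L by eventually_elim auto
    from mem_closed_if_AE_lebesgue[OF closed_Collect_const this, of 0] show ?thesis by (simp split: if_splits)
  qed
  have main: "\<bar>b x - b y\<bar> \<le> L * (y - x) + \<epsilon>" if xy: "x < y" and \<epsilon>: "0 < \<epsilon>" for x y \<epsilon> :: real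
  proof -
    \<comment> \<open>Half of \<epsilon> pays for the oscillation of \<open>b\<close> near the two
      points (twice \<open>\<kappa>\<close>), the other half for the excess length 2
      \<open>r\<close> of the support of the test function.\<close>
    define \<kappa> where "\<kappa> = \<epsilon> / 4"
    have \<kappa>: "0 < \<kappa>" using \<epsilon> by (simp add: \<kappa>_def)
    have "\<exists>d>0. \<forall>t. \<bar>t - p\<bar> < d \<longrightarrow> \<bar>b t - b p\<bar> < \<kappa>" for p
      using b \<kappa> by (auto simp: continuous_on_iff dist_real_def)
    then obtain d1 d2 where d: "0 < d1" "\<And>t. \<bar>t - x\<bar> < d1 \<Longrightarrow> \<bar>b t - b x\<bar> < \<kappa>"
      "0 < d2" "\<And>t. \<bar>t - y\<bar> < d2 \<Longrightarrow> \<bar>b t - b y\<bar> < \<kappa>" by metis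
    \<comment> \<open>The third bound gives L * 2 r <= \<epsilon> / 2; \<open>L + 1\<close> in the
      denominator covers the case \<open>L = 0\<close>.\<close>
    define r where "r = min (min d1 d2) (\<epsilon> / (4 * (L + 1))) "
    have r: "0 < r" "r \<le> d1" "r \<le> d2" "r \<le> \<epsilon> / (4 * (L + 1))"
      using d \<epsilon> L0 by (auto simp: r_def)
    have Lr: "L * (2 * r) \<le> \<epsilon> / 2"
    proof -
      have "L * (2 * r) \<le> (L + 1) * (2 * r)" using r(1) by simp
      also have "\<dots> \<le> (L + 1) * (2 * (\<epsilon> / (4 * (L + 1))))" using r(4) L0 by (intro mult_left_mono) auto
      also have "\<dots> = \<epsilon> / 2" using L0 by (simp add: field_simps)
      finally show ?thesis .
    qed
    define \<beta> :: "real \<Rightarrow> real \<Rightarrow> real" where "\<beta> p = box_bump (p - r) (p + r) 1" for p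
    have shift: "\<beta> p t = \<beta> 0 (t - p)" for p t by (simp add: \<beta>_def box_bump_def algebra_simps)
    have smooth: "C_k k (\<beta> p)" for k p unfolding \<beta>_def by (rule C_k_box_bump) simp
    have cont: "continuous_on UNIV (\<beta> p)" for p using smooth[of 0] by simp
    have nonneg: "0 \<le> \<beta> p t" for p t unfolding \<beta>_def by (rule box_bump_nonneg) simp
    have nz: "\<beta> p t \<noteq> 0 \<longleftrightarrow> \<bar>t - p\<bar> < r" for p t
      by (auto simp: \<beta>_def box_bump_nonzero_iff)
    have [measurable]: "\<beta> p \<in> borel_measurable borel" for p by (rule borel_measurable_continuous_onI[OF cont])
    have cs: "\<beta> p t = 0" if "t \<notin> {p - r..p + r}" for p t using that nz[of p t] by auto
    obtain H where H: "\<And>t. (H has_real_derivative \<beta> 0 t) (at t)"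
      using einterval_antiderivative[of "-\<infinity>" "\<infinity>" "\<beta> 0"] cont[of 0]
      by (auto simp: continuous_on_eq_continuous_at has_real_derivative_iff_has_vector_derivative)
    define Z where "Z = H r - H (- r)"
    have mono: "H s \<le> H t" if "s \<le> t" for s t
      using that by (rule DERIV_nonneg_imp_nondecreasing) (use H nonneg in blast)
    have left: "H t = H (- r)" if "t \<le> - r" for t
    proof (cases "t = - r")
      case False
      then have "t < - r" using that by simp
      from MVT2[OF this H] obtain z where "z < - r" "H (- r) - H t = (- r - t) * \<beta> 0 z" by blast
      then show ?thesis using nz[of 0 z] r(1) by auto
    qed simp
    have right: "H t = H r" if "r \<le> t" for t
    proof (cases "t = r")
      case False
      then have "r < t" using that by simp
      from MVT2[OF this H] obtain z where "r < z" "H t - H r = (t - r) * \<beta> 0 z" by blast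
      then show ?thesis using nz[of 0 z] r(1) by auto
    qed simp
    have bnd: "H (- r) \<le> H t" "H t \<le> H r" for t
      using left[of t] right[of t] mono[of "- r" t] mono[of t r] mono[of "- r" r] r(1) by linarith+
    have Z: "0 < Z"
    proof -
      have "- r < r" using r by simp
      from MVT2[OF this H] obtain z where "- r < z" "z < r" "Z = (r - (- r)) * \<beta> 0 z"
        unfolding Z_def by blast
      moreover have "0 < \<beta> 0 z" using nz[of 0 z] nonneg[of 0 z] calculation by auto
      ultimately show ?thesis using r(1) by simp
    qed
    have int: "integrable lebesgue (\<lambda>t. f t * \<beta> p t)" if f: "continuous_on UNIV f" for f p
      by (rule integrable_lebesgue_compact_support[OF compact_Icc[of "p - r" "p + r"]])
        (use cs in \<open>auto intro!: continuous_intros f cont\<close>)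
    have mass: "(LINT t|lebesgue. \<beta> p t) = Z" for p
    proof -
      have "(LINT t|lebesgue. \<beta> p t) = (LINT t|lborel. \<beta> p t)" by (rule integral_completion) measurable
      also have "\<dots> = (LINT t|lborel. indicator {p - r..p + r} t *\<^sub>R \<beta> p t)"
        by (rule Bochner_Integration.integral_cong) (use cs in \<open>auto simp: indicator_def\<close>)
      also have "\<dots> = H ((p + r) - p) - H ((p - r) - p)"
      proof (rule integral_FTC_atLeastAtMost[where F = "\<lambda>t. H (t - p)"])
        fix t
        have "((\<lambda>t. H (t - p)) has_real_derivative \<beta> 0 (t - p) * 1) (at t)"
          by (rule DERIV_chain'[OF _ H]) (auto intro!: derivative_eq_intros)
        then show "((\<lambda>t. H (t - p)) has_vector_derivative \<beta> p t) (at t within {p - r..p + r})"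
          by (simp add: shift[of p t] has_real_derivative_iff_has_vector_derivative[symmetric] has_field_derivative_at_within)
      qed (use r(1) cont in \<open>auto intro: continuous_on_subset\<close>)
      finally show ?thesis by (simp add: Z_def)
    qed
    have approx: "\<bar>(LINT t|lebesgue. b t * \<beta> p t) - b p * Z\<bar> \<le> \<kappa> * Z"
      if p: "\<And>t. \<bar>t - p\<bar> < r \<Longrightarrow> \<bar>b t - b p\<bar> < \<kappa>" for p
    proof -
      have i: "integrable lebesgue (\<lambda>t. b t * \<beta> p t)" "integrable lebesgue (\<lambda>t. b p * \<beta> p t)"
        "integrable lebesgue (\<lambda>t. \<kappa> * \<beta> p t)" "integrable lebesgue (\<lambda>t. (b t - b p) * \<beta> p t)"
        by (intro int continuous_intros b)+
      have "(LINT t|lebesgue. b t * \<beta> p t) - b p * Z = (LINT t|lebesgue. b t * \<beta> p t) - (LINT t|lebesgue. b p * \<beta> p t)"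
        by (simp add: mass)
      also have "\<dots> = (LINT t|lebesgue. (b t - b p) * \<beta> p t)"
        using i(1,2) by (simp add: left_diff_distrib)
      also have "\<bar>\<dots>\<bar> \<le> (LINT t|lebesgue. \<bar>(b t - b p) * \<beta> p t\<bar>)" by (rule integral_abs_bound)
      also have "\<dots> \<le> (LINT t|lebesgue. \<kappa> * \<beta> p t)"
      proof (rule integral_mono)
        show "\<bar>(b t - b p) * \<beta> p t\<bar> \<le> \<kappa> * \<beta> p t" for t
          using p[of t] nz[of p t] nonneg[of p t] by (cases "\<beta> p t = 0") (auto simp: abs_mult intro!: mult_right_mono)
      qed (use i in auto)
      also have "\<dots> = \<kappa> * Z" by (simp add: mass)
      finally show ?thesis .
    qed
    \<comment> \<open>With this sign the integral of \<open>b\<close> against the derivative of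
      \<open>\<phi>\<close> is close to \<open>Z\<close> times \<open>b x - b y\<close>, where
      \<open>Z\<close> is the mass of a bump.\<close>
    define \<phi> where "\<phi> t = H (t - x) - H (t - y)" for t
    have d\<phi>: "(\<phi> has_derivative (\<lambda>h. h * (\<beta> x t - \<beta> y t))) (at t)" for t
    proof -
      have "((\<lambda>t. H (t - p)) has_real_derivative \<beta> p t * 1) (at t)" for p
        unfolding shift[of p] by (rule DERIV_chain'[OF _ H]) (auto intro!: derivative_eq_intros)
      then have "(\<phi> has_real_derivative \<beta> x t - \<beta> y t) (at t)"
        unfolding \<phi>_def by (auto intro!: derivative_eq_intros)
      then show ?thesis by (simp add: has_field_derivative_def mult.commute[of _ "\<beta> x t - \<beta> y t"])
    qed
    have fd: "frechet_derivative \<phi> (at t) 1 = \<beta> x t - \<beta> y t" for t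
      using frechet_derivative_eqI[OF d\<phi>, of t 1] by simp
    have "C_k (Suc k) \<phi>" for k
      using d\<phi> C_k_add[OF smooth C_k_mult[OF C_k_const smooth], of k x "-1" y]
      by (auto simp: differentiable_on_def differentiable_def fd)
    then have "C_k k \<phi>" for k by (rule C_k_Suc_imp_C_k)
    \<comment> \<open>Away from the interval both translates of \<open>H\<close> have reached the
      same constant value, so they cancel.\<close>
    moreover have \<phi>0: "\<phi> t = 0" if "t \<notin> {x - r..y + r}" for t
    proof -
      from that consider "t < x - r" | "y + r < t" by force
      then show ?thesis
      proof cases
        case 1
        then show ?thesis using left[of "t - x"] left[of "t - y"] xy by (simp add: \<phi>_def)
      next
        case 2
        then show ?thesis using right[of "t - x"] right[of "t - y"] xy by (simp add: \<phi>_def)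
      qed
    qed
    ultimately have \<phi>: "\<phi> \<in> test_functions UNIV"
      by (intro test_functionsI[of _ "{x - r..y + r}"]) blast+
    \<comment> \<open>Both terms lie between \<open>H (- r)\<close> and \<open>H r\<close>. Hence
      \<open>Z\<close> is a factor on both sides of the final estimate and cancels.\<close>
    have \<phi>Z: "\<bar>\<phi> t\<bar> \<le> Z" for t
      using bnd[of "t - x"] bnd[of "t - y"] by (simp add: \<phi>_def Z_def)
    have eq: "(LINT t|lebesgue. b t * (\<beta> x t - \<beta> y t)) = - (LINT t|lebesgue. g t * \<phi> t)"
      using bspec[OF conjunct2[OF conjunct2[OF g[unfolded has_weak_partial_def]]] \<phi>]
      by (simp add: fd lebesgue_on_UNIV_eq)
    have ig: "integrable lebesgue (\<lambda>t. g t * \<phi> t)"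
      using locally_integrable_times_test(1)[OF open_UNIV _ \<phi>] g
      by (simp add: has_weak_partial_def lebesgue_on_UNIV_eq)
    have "\<bar>LINT t|lebesgue. g t * \<phi> t\<bar> \<le> (LINT t|lebesgue. \<bar>g t * \<phi> t\<bar>)" by (rule integral_abs_bound)
    also have "\<dots> \<le> (LINT t|lebesgue. L * Z * indicator {x - r..y + r} t)"
    proof (rule integral_mono_AE)
      show "AE t in lebesgue. \<bar>g t * \<phi> t\<bar> \<le> L * Z * indicator {x - r..y + r} t"
        using L
      proof eventually_elim
        case (elim t)
        show ?case
        proof (cases "t \<in> {x - r..y + r}")
          case True
          have "\<bar>g t * \<phi> t\<bar> \<le> L * Z" unfolding abs_mult by (intro mult_mono elim \<phi>Z L0) simp
          with True show ?thesis by simp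
        qed (simp add: \<phi>0)
      qed
      show "integrable lebesgue (\<lambda>t. L * Z * indicator {x - r..y + r} t)"
        by (intro integrable_mult_right integrable_real_indicator) (auto simp: emeasure_lborel_Icc_eq)
    qed (use ig in auto)
    also have "\<dots> = L * Z * (y - x + 2 * r)" using xy r(1) by simp
    finally have "\<bar>LINT t|lebesgue. b t * (\<beta> x t - \<beta> y t)\<bar> \<le> L * Z * (y - x + 2 * r)"
      unfolding eq by simp
    moreover have "(LINT t|lebesgue. b t * (\<beta> x t - \<beta> y t)) = (LINT t|lebesgue. b t * \<beta> x t) - (LINT t|lebesgue. b t * \<beta> y t)"
      using int[OF b] by (simp add: right_diff_distrib)
    moreover have "\<bar>(LINT t|lebesgue. b t * \<beta> x t) - b x * Z\<bar> \<le> \<kappa> * Z"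
      "\<bar>(LINT t|lebesgue. b t * \<beta> y t) - b y * Z\<bar> \<le> \<kappa> * Z"
      using approx d r by (meson less_le_trans)+
    ultimately have "\<bar>b x * Z - b y * Z\<bar> \<le> L * Z * (y - x + 2 * r) + 2 * (\<kappa> * Z)" by linarith
    also have "\<dots> = (L * (y - x + 2 * r) + 2 * \<kappa>) * Z" by (simp add: algebra_simps)
    also have "\<bar>b x * Z - b y * Z\<bar> = \<bar>b x - b y\<bar> * Z"
      using Z by (simp add: left_diff_distrib[symmetric] abs_mult)
    finally have "\<bar>b x - b y\<bar> \<le> L * (y - x + 2 * r) + 2 * \<kappa>" using Z by simp
    then show ?thesis using Lr by (simp add: \<kappa>_def distrib_left)
  qed
  have lt: "\<bar>b x - b y\<bar> \<le> L * \<bar>x - y\<bar>" if "x < y" for x y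
    using field_le_epsilon[OF main[OF that]] that by simp
  consider "x < y" | "x = y" | "y < x" by linarith
  then show ?thesis by cases (use lt[of x y] lt[of y x] in \<open>auto simp: abs_minus_commute\<close>)
qed

text \<open>By continuity the set where |b| is at most the essential bound is closed, and a closed
  set of full measure is everything. The Lipschitz constant is the essential bound of the first weak
  derivative.\<close>

lemma sobolev_2_infinity_bounded_Lipschitz:
  fixes b :: "real \<Rightarrow> real"
  assumes b: "continuous_on UNIV b" and s: "b \<in> sobolev 2 \<infinity> UNIV"
  obtains B L where "\<And>t. \<bar>b t\<bar> \<le> B" "\<And>s t. \<bar>b s - b t\<bar> \<le> L * \<bar>s - t\<bar>"
proof -
  from s obtain g where "b \<in> Lp_space \<infinity> UNIV" "g \<in> Lp_space \<infinity> UNIV" and g: "has_weak_partial UNIV 1 b g"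
    by (auto simp: numeral_2_eq_2)
  then obtain B L where B: "AE x in lebesgue. \<bar>b x\<bar> \<le> B" and L: "AE x in lebesgue. \<bar>g x\<bar> \<le> L"
    unfolding Lp_space_def lebesgue_on_UNIV_eq by auto
  have "closed {x. \<bar>b x\<bar> \<le> B}"
    by (intro closed_Collect_le continuous_intros b)
  from mem_closed_if_AE_lebesgue[OF this] B have "\<bar>b t\<bar> \<le> B" for t by auto
  with weak_derivative_bounded_imp_Lipschitz[OF b g L] show ?thesis by (rule that[rotated])
qed

section \<open>Quasi-optimality\<close>

lemma Lp_norm_6_powr_6:
  fixes u :: "'a::euclidean_space \<Rightarrow> real"
  shows "Lp_norm 6 S u powr 6 = (LINT x|lebesgue_on S. u x ^ 6)"
proof -
  have "norm (u x) powr 6 = u x ^ 6" for x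
    using powr_realpow'[of "\<bar>u x\<bar>" 6] power_even_abs[of 6 "u x"] by simp
  moreover have "0 \<le> (LINT x|lebesgue_on S. u x ^ 6)" by simp
  ultimately show ?thesis by (simp add: Lp_norm_def powr_powr)
qed

text \<open>A Hoelder-type bound obtained pointwise: fourth powers of the components are compared
  with sixth powers plus a constant. The weights in \<delta> are scaled so that both contributions,
  area times \<delta>^4 and \<delta>^6 / \<delta>^2, are of order \<delta>^4.\<close>

lemma W16_weak_grad_power4:
  fixes u :: "real^2 \<Rightarrow> real"
  assumes S: "open S" "bounded S" and u: "u \<in> sobolev 1 6 S" "W1p_norm 6 S u \<le> \<delta>" and \<delta>: "0 < \<delta>"
  shows "integrable (lebesgue_on S) (\<lambda>x. norm (weak_grad S u x) ^ 4)"
    "(LINT x|lebesgue_on S. norm (weak_grad S u x) ^ 4) \<le> 4 * \<delta> ^ 4 * (measure lborel S + 1)"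
proof -
  define m where "m = measure lborel S"
  let ?M = "lebesgue_on S"
  define g where "g i x = weak_grad S u x \<bullet> axis i 1" for i :: 2 and x
  have Lp: "g i \<in> Lp_space 6 S" for i
    using sobolev_1_has_weak_grad(2)[OF S(1) u(1), of "axis i 1"] by (simp add: g_def[abs_def] axis_1_in_Basis)
  then have [measurable]: "g i \<in> borel_measurable ?M" and i6: "integrable ?M (\<lambda>x. g i x ^ 6)" for i
    by (simp_all add: Lp_space_6_iff)
  have g6: "(LINT x|?M. g i x ^ 6) \<le> \<delta> ^ 6" for i
  proof -
    define T where "T = (LINT x|?M. u x ^ 6) + ((LINT x|?M. g 1 x ^ 6) + (LINT x|?M. g 2 x ^ 6))"
    have nn: "0 \<le> (LINT x|?M. u x ^ 6)" "0 \<le> (LINT x|?M. g i x ^ 6)" for i by simp_all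
    have T0: "0 \<le> T" unfolding T_def by (intro add_nonneg_nonneg nn)
    have "W1p_norm 6 S u = T powr (1 / 6)"
      using Basis_real2(2) by (simp add: W1p_norm_def Lp_norm_6_powr_6 Basis_real2(1) T_def g_def)
    then have "(T powr (1 / 6)) powr 6 \<le> \<delta> powr 6"
      using u(2) by (intro powr_mono2) auto
    then have "T \<le> \<delta> ^ 6" using T0 \<delta> by (simp add: powr_powr)
    then have "(LINT x|?M. g 1 x ^ 6) \<le> \<delta> ^ 6" "(LINT x|?M. g 2 x ^ 6) \<le> \<delta> ^ 6"
      using nn(1) nn(2)[of 1] nn(2)[of 2] unfolding T_def by linarith+
    then show ?thesis using exhaust_2[of i] by auto
  qed
  have S': "S \<in> sets lebesgue" by (rule open_sets_lebesgue[OF S(1)])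
  have meas: "measure ?M S = m"
    using S' S(1) by (simp add: measure_restrict_space m_def)
  interpret finite_measure ?M
    using S by (intro finite_measure_lebesgue_on lmeasurable_open)
  have pt: "norm (weak_grad S u x) ^ 4 \<le> 2 * (\<delta> ^ 4 + g 1 x ^ 6 / \<delta>\<^sup>2) + 2 * (\<delta> ^ 4 + g 2 x ^ 6 / \<delta>\<^sup>2)" for x
  proof -
    \<comment> \<open>Small values of y are bounded by the first term; for large ones the factor y^2
      / \<delta>^2 exceeds 1.\<close>
    have y: "y ^ 4 \<le> \<delta> ^ 4 + y ^ 6 / \<delta>\<^sup>2" for y :: real
    proof (cases "y\<^sup>2 \<le> \<delta>\<^sup>2")
      case True
      then have "y ^ 4 \<le> \<delta> ^ 4" using power_mono[of "y\<^sup>2" "\<delta>\<^sup>2" 2] by simp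
      moreover have "0 \<le> y ^ 6 / \<delta>\<^sup>2" by simp
      ultimately show ?thesis by linarith
    next
      case False
      then have "y ^ 4 * \<delta>\<^sup>2 \<le> y ^ 4 * y\<^sup>2" by (intro mult_left_mono) auto
      then have "y ^ 4 \<le> y ^ 6 / \<delta>\<^sup>2" using \<delta> by (simp add: pos_le_divide_eq flip: power_add)
      moreover have "0 \<le> \<delta> ^ 4" by simp
      ultimately show ?thesis by linarith
    qed
    have "norm (weak_grad S u x) ^ 4 = ((g 1 x)\<^sup>2 + (g 2 x)\<^sup>2)\<^sup>2"
      using norm_square_eq_sum_Basis[of "weak_grad S u x"] Basis_real2(2)
      by (simp add: Basis_real2(1) g_def flip: power_mult) (metis power_mult numeral_times_numeral mult_2 numeral_Bit0)
    also have "\<dots> \<le> 2 * ((g 1 x)\<^sup>2)\<^sup>2 + 2 * ((g 2 x)\<^sup>2)\<^sup>2"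
      using square_norm_add_le[of "(g 1 x)\<^sup>2" "(g 2 x)\<^sup>2"] by simp
    also have "\<dots> = 2 * g 1 x ^ 4 + 2 * g 2 x ^ 4" by simp
    also have "\<dots> \<le> 2 * (\<delta> ^ 4 + g 1 x ^ 6 / \<delta>\<^sup>2) + 2 * (\<delta> ^ 4 + g 2 x ^ 6 / \<delta>\<^sup>2)"
      by (intro add_mono mult_left_mono y) auto
    finally show ?thesis .
  qed
  have ib: "integrable ?M (\<lambda>x. 2 * (\<delta> ^ 4 + g 1 x ^ 6 / \<delta>\<^sup>2) + 2 * (\<delta> ^ 4 + g 2 x ^ 6 / \<delta>\<^sup>2))"
    using i6 by simp
  have "weak_grad S u \<in> borel_measurable ?M"
  proof (subst borel_measurable_euclidean_space, intro ballI)
    fix i :: "real^2" assume "i \<in> Basis"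
    then have "i = axis 1 1 \<or> i = axis 2 1" by (simp add: Basis_real2(1))
    then have "(\<lambda>x. weak_grad S u x \<bullet> i) = g 1 \<or> (\<lambda>x. weak_grad S u x \<bullet> i) = g 2"
      by (auto simp: g_def fun_eq_iff)
    then show "(\<lambda>x. weak_grad S u x \<bullet> i) \<in> borel_measurable ?M" by auto
  qed
  note [measurable] = this
  show i: "integrable ?M (\<lambda>x. norm (weak_grad S u x) ^ 4)"
    by (rule Bochner_Integration.integrable_bound[OF ib]) (measurable, use pt in \<open>auto intro!: AE_I2 order_trans[OF _ abs_ge_self]\<close>)
  have "(LINT x|?M. norm (weak_grad S u x) ^ 4)
      \<le> (LINT x|?M. 2 * (\<delta> ^ 4 + g 1 x ^ 6 / \<delta>\<^sup>2) + 2 * (\<delta> ^ 4 + g 2 x ^ 6 / \<delta>\<^sup>2))"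
    by (rule integral_mono[OF i ib pt])
  also have "\<dots> = 4 * \<delta> ^ 4 * m + 2 * ((LINT x|?M. g 1 x ^ 6) / \<delta>\<^sup>2) + 2 * ((LINT x|?M. g 2 x ^ 6) / \<delta>\<^sup>2)"
    using i6 by (simp add: meas algebra_simps)
  also have "\<dots> \<le> 4 * \<delta> ^ 4 * m + 2 * (\<delta> ^ 6 / \<delta>\<^sup>2) + 2 * (\<delta> ^ 6 / \<delta>\<^sup>2)"
    using g6 by (intro add_mono mult_left_mono divide_right_mono order_refl) auto
  also have "\<dots> = 4 * \<delta> ^ 4 * (m + 1)"
    using \<delta> by (simp add: algebra_simps power_diff[symmetric])
  finally show "(LINT x|?M. norm (weak_grad S u x) ^ 4) \<le> 4 * \<delta> ^ 4 * (measure lborel S + 1)"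
    by (simp add: m_def)
qed

lemma H10_sobolev: "u \<in> H10 S \<Longrightarrow> u \<in> sobolev 1 2 S"
  by (simp add: H10_def)

text \<open>The error \<open>E\<close> still stands on the right with a factor proportional to
  \<delta>, and \<delta> is free here; the choice that allows absorption is left to the theorem. Of
  the two weak formulations only their consequence for the single test function
  \<open>w - u\<^sub>r\<close> enters, as \<open>orth\<close>.\<close>

lemma Galerkin_energy_estimate:
  fixes \<Omega> :: "(real^2) set" and \<alpha>\<^sub>0 \<alpha>\<^sub>1 b\<^sub>0 B L \<delta> :: real and b :: "real \<Rightarrow> real"
  assumes \<Omega>: "open \<Omega>" "bounded \<Omega>"
    and \<alpha>: "\<alpha> \<in> borel_measurable (lebesgue_on \<Omega>)" "AE x in lebesgue_on \<Omega>. \<alpha>\<^sub>0 \<le> \<alpha> x \<and> \<alpha> x \<le> \<alpha>\<^sub>1" "0 < \<alpha>\<^sub>0" "\<alpha>\<^sub>0 \<le> \<alpha>\<^sub>1"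
    and b: "continuous_on UNIV b" "0 < b\<^sub>0" "\<And>t. b\<^sub>0 \<le> b t" "\<And>t. \<bar>b t\<bar> \<le> B"
    and L: "\<And>s t. \<bar>b s - b t\<bar> \<le> L * \<bar>s - t\<bar>" "0 \<le> L"
    and u: "u \<in> H10 \<Omega>" and ur: "u\<^sub>r \<in> H10 \<Omega>" and w: "w \<in> H10 \<Omega>"
    and orth: "(LINT x|lebesgue_on \<Omega>. \<alpha> x * b (u x) * (weak_grad \<Omega> u x \<bullet> weak_grad \<Omega> (\<lambda>x. w x - u\<^sub>r x) x))
      = (LINT x|lebesgue_on \<Omega>. \<alpha> x * b (u\<^sub>r x) * (weak_grad \<Omega> u\<^sub>r x \<bullet> weak_grad \<Omega> (\<lambda>x. w x - u\<^sub>r x) x))"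
    and small: "integrable (lebesgue_on \<Omega>) (\<lambda>x. norm (weak_grad \<Omega> u x) ^ 4)"
      "(LINT x|lebesgue_on \<Omega>. norm (weak_grad \<Omega> u x) ^ 4) \<le> 4 * \<delta> ^ 4 * (measure lborel \<Omega> + 1)" "0 < \<delta>"
  defines "E \<equiv> Lp_norm 2 \<Omega> (weak_grad \<Omega> (\<lambda>x. u x - u\<^sub>r x))"
    and "D \<equiv> Lp_norm 2 \<Omega> (weak_grad \<Omega> (\<lambda>x. u x - w x))"
    and "\<kappa> \<equiv> 64 * measure lborel \<Omega> * (measure lborel \<Omega> + 1) + 1"
  shows "\<alpha>\<^sub>0 * b\<^sub>0 * E\<^sup>2 \<le> \<alpha>\<^sub>1 * B * (E * D) + \<alpha>\<^sub>1 * L * (\<kappa> * \<delta> * E * (E + D))"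
proof -
  define m where "m = measure lborel \<Omega>"
  let ?M = "lebesgue_on \<Omega>"
  define e where "e x = u x - u\<^sub>r x" for x
  define d where "d x = u x - w x" for x
  define v where "v x = w x - u\<^sub>r x" for x
  note grad = sobolev_1_2D[OF \<Omega>(1) H10_sobolev]
  have e: "e \<in> H10 \<Omega>" and d: "d \<in> H10 \<Omega>" and v: "v \<in> H10 \<Omega>"
    unfolding e_def d_def v_def by (intro H10_diff \<Omega> u ur w)+
  define ge gd gv gu gr where "ge = weak_grad \<Omega> e" and "gd = weak_grad \<Omega> d" and "gv = weak_grad \<Omega> v"
    and "gu = weak_grad \<Omega> u" and "gr = weak_grad \<Omega> u\<^sub>r"
  note defs = ge_def gd_def gv_def gu_def gr_def
  have [measurable]: "ge \<in> borel_measurable ?M" "gd \<in> borel_measurable ?M" "gv \<in> borel_measurable ?M"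
    "gu \<in> borel_measurable ?M" "gr \<in> borel_measurable ?M"
    unfolding defs by (intro grad(4) e d v u ur)+
  have [measurable]: "e \<in> borel_measurable ?M" "u \<in> borel_measurable ?M" "u\<^sub>r \<in> borel_measurable ?M"
    by (intro grad(1) e u ur)+
  have [measurable]: "b \<in> borel_measurable borel" by (rule borel_measurable_continuous_onI[OF b(1)])
  note [measurable] = \<alpha>(1)
  have sq: "integrable ?M (\<lambda>x. (norm (ge x))\<^sup>2)" "integrable ?M (\<lambda>x. (norm (gd x))\<^sup>2)"
    "integrable ?M (\<lambda>x. (norm (gv x))\<^sup>2)" "integrable ?M (\<lambda>x. (norm (gu x))\<^sup>2)" "integrable ?M (\<lambda>x. (norm (gr x))\<^sup>2)"
    unfolding defs by (intro grad(5) e d v u ur)+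
  have ae_e: "AE x in ?M. ge x = gu x - gr x"
    unfolding defs by (rule weak_grad_unique[OF \<Omega>(1)]) (unfold e_def, intro has_weak_grad_diff \<Omega> grad(3) u ur)
  have ae_v: "AE x in ?M. gv x = ge x - gd x"
  proof -
    have "has_weak_grad \<Omega> v (\<lambda>x. ge x - gd x)"
      using has_weak_grad_diff[OF \<Omega>(1) grad(3)[OF e] grad(3)[OF d]] by (simp add: defs v_def[abs_def] d_def[abs_def] e_def[abs_def])
    from weak_grad_unique[OF \<Omega>(1) this] show ?thesis by (simp add: gv_def)
  qed
  have E0: "0 \<le> E" and D0: "0 \<le> D" by (simp_all add: E_def D_def Lp_norm_2)
  have E2: "(LINT x|?M. (norm (ge x))\<^sup>2) = E\<^sup>2" and D2: "(LINT x|?M. (norm (gd x))\<^sup>2) = D\<^sup>2"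
    by (simp_all add: E_def D_def Lp_norm_2 ge_def gd_def e_def[abs_def] d_def[abs_def])
  have B0: "0 \<le> B" using b(4)[of 0] by linarith
  have m0: "0 \<le> m" by (simp add: m_def)
  define p where "p x = \<bar>e x\<bar> * norm (gu x)" for x
  have [measurable]: "p \<in> borel_measurable ?M" unfolding p_def by measurable
  have m4: "integrable ?M (\<lambda>x. ((e x)\<^sup>2)\<^sup>2)" "integrable ?M (\<lambda>x. ((norm (gu x))\<^sup>2)\<^sup>2)"
    using H10_integral_power4(1)[OF \<Omega> e] small(1) by (simp_all add: gu_def)
  have p2: "(p x)\<^sup>2 = (e x)\<^sup>2 * (norm (gu x))\<^sup>2" for x by (simp add: p_def power_mult_distrib)
  have cs4: "integrable ?M (\<lambda>x. (p x)\<^sup>2)"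
    "(LINT x|?M. (p x)\<^sup>2)\<^sup>2 \<le> (LINT x|?M. ((e x)\<^sup>2)\<^sup>2) * (LINT x|?M. ((norm (gu x))\<^sup>2)\<^sup>2)"
    unfolding p2 using Cauchy_Schwarz_integral[OF _ _ m4] by simp_all
  \<comment> \<open>The L^2 norm of e grad u, the only place where the smallness of u acts.\<close>
  define P where "P = sqrt (LINT x|?M. (p x)\<^sup>2)"
  have P0: "0 \<le> P" and P2: "P\<^sup>2 = (LINT x|?M. (p x)\<^sup>2)" by (simp_all add: P_def)
  have "P ^ 4 \<le> (\<kappa> * \<delta> * E) ^ 4"
  proof -
    have "P ^ 4 = (P\<^sup>2)\<^sup>2" by simp
    also have "\<dots> \<le> (LINT x|?M. ((e x)\<^sup>2)\<^sup>2) * (LINT x|?M. ((norm (gu x))\<^sup>2)\<^sup>2)" using cs4(2) by (simp add: P2)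
    also have "\<dots> \<le> (16 * m * (E\<^sup>2)\<^sup>2) * (4 * \<delta> ^ 4 * (m + 1))"
    proof (rule mult_mono)
      show "(LINT x|?M. ((e x)\<^sup>2)\<^sup>2) \<le> 16 * m * (E\<^sup>2)\<^sup>2"
        using H10_integral_power4(2)[OF \<Omega> e] E2 by (simp add: ge_def m_def)
      show "(LINT x|?M. ((norm (gu x))\<^sup>2)\<^sup>2) \<le> 4 * \<delta> ^ 4 * (m + 1)"
        using small(2) by (simp add: gu_def m_def)
    qed (use m0 in auto)
    also have "\<dots> = (64 * m * (m + 1)) * (\<delta> * E) ^ 4" by (simp add: power_mult_distrib algebra_simps)
    also have "\<dots> \<le> \<kappa> ^ 4 * (\<delta> * E) ^ 4"
    proof (rule mult_right_mono)
      \<comment> \<open>The summand 1 in \<open>\<kappa>\<close> ensures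
        \<open>\<kappa> \<le> \<kappa> ^ 4\<close>, so that the constant 64 m (m + 1) is a fourth
        power up to an inequality and no fourth root has to be written.\<close>
      have "1 \<le> \<kappa>" using m0 by (simp add: \<kappa>_def m_def)
      then have "\<kappa> ^ 1 \<le> \<kappa> ^ 4" by (intro power_increasing) auto
      then show "64 * m * (m + 1) \<le> \<kappa> ^ 4" by (simp add: \<kappa>_def m_def)
    qed simp
    finally show ?thesis by (simp add: power_mult_distrib mult.assoc)
  qed
  moreover have "0 \<le> \<kappa> * \<delta> * E" using m0 small(3) E0 by (simp add: \<kappa>_def m_def)
  ultimately have P: "P \<le> \<kappa> * \<delta> * E" using power_mono_iff[OF P0, of "\<kappa> * \<delta> * E" 4] by simp
  \<comment> \<open>Cauchy-Schwarz with the two L^2 norms given by name; it is applied to the pairs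
    (ge, gd), (p, ge) and (p, gd), which are the three products in the estimate.\<close>
  have cs: "integrable ?M (\<lambda>x. f x * norm (g x))" "(LINT x|?M. f x * norm (g x)) \<le> F * G"
    if [measurable]: "f \<in> borel_measurable ?M" "g \<in> borel_measurable ?M"
    and fg: "integrable ?M (\<lambda>x. (f x)\<^sup>2)" "integrable ?M (\<lambda>x. (norm (g x))\<^sup>2)"
      "(LINT x|?M. (f x)\<^sup>2) = F\<^sup>2" "(LINT x|?M. (norm (g x))\<^sup>2) = G\<^sup>2" "0 \<le> F" "0 \<le> G"
    for f :: "real^2 \<Rightarrow> real" and g :: "real^2 \<Rightarrow> real^2" and F G
  proof -
    note c = Cauchy_Schwarz_integral[OF _ _ fg(1,2)]
    show i: "integrable ?M (\<lambda>x. f x * norm (g x))" by (rule c(1)) measurable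
    have "(LINT x|?M. \<bar>f x * norm (g x)\<bar>)\<^sup>2 \<le> (F * G)\<^sup>2" using c(2) by (simp add: fg power_mult_distrib)
    then have "(LINT x|?M. \<bar>f x * norm (g x)\<bar>) \<le> F * G" by (rule power2_le_imp_le) (simp add: fg)
    moreover have "(LINT x|?M. f x * norm (g x)) \<le> (LINT x|?M. \<bar>f x * norm (g x)\<bar>)"
      using integral_abs_bound[of ?M "\<lambda>x. f x * norm (g x)"] by linarith
    ultimately show "(LINT x|?M. f x * norm (g x)) \<le> F * G" by linarith
  qed
  note c1 = cs[of "\<lambda>x. norm (ge x)" gd E D, OF _ _ sq(1) sq(2) E2 D2 E0 D0]
  note c2 = cs[of p ge P E, OF _ _ cs4(1) sq(1) P2[symmetric] E2 P0 E0]
  note c3 = cs[of p gd P D, OF _ _ cs4(1) sq(2) P2[symmetric] D2 P0 D0]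
  have ix: "integrable ?M (\<lambda>x. \<alpha> x * b (z x) * (g x \<bullet> gv x))"
    if [measurable]: "z \<in> borel_measurable ?M" "g \<in> borel_measurable ?M" and g: "integrable ?M (\<lambda>x. (norm (g x))\<^sup>2)"
    for z :: "real^2 \<Rightarrow> real" and g :: "real^2 \<Rightarrow> real^2"
  proof (rule Bochner_Integration.integrable_bound)
    have "integrable ?M (\<lambda>x. norm (g x) * norm (gv x))"
      by (rule Cauchy_Schwarz_integral(1)) (measurable, use g sq in auto)
    then show "integrable ?M (\<lambda>x. \<alpha>\<^sub>1 * B * (norm (g x) * norm (gv x)))" by simp
    show "AE x in ?M. norm (\<alpha> x * b (z x) * (g x \<bullet> gv x)) \<le> norm (\<alpha>\<^sub>1 * B * (norm (g x) * norm (gv x)))"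
      using \<alpha>(2)
    proof eventually_elim
      case (elim x)
      have "\<bar>\<alpha> x\<bar> \<le> \<bar>\<alpha>\<^sub>1\<bar>" "\<bar>b (z x)\<bar> \<le> \<bar>B\<bar>" using elim \<alpha>(3) b(4)[of "z x"] by linarith+
      then show ?case
        using Cauchy_Schwarz_ineq2[of "g x" "gv x"] by (auto simp: abs_mult intro!: mult_mono)
    qed
  qed measurable
  \<comment> \<open>The difference of the two integrands in \<open>orth\<close>. As its integral is
    0, it may be added freely, and the whole estimate reduces to a pointwise one.\<close>
  define X where "X x = \<alpha> x * b (u x) * (gu x \<bullet> gv x) - \<alpha> x * b (u\<^sub>r x) * (gr x \<bullet> gv x)" for x
  have iX: "integrable ?M X" "(LINT x|?M. X x) = 0"
  proof -
    have i: "integrable ?M (\<lambda>x. \<alpha> x * b (u x) * (gu x \<bullet> gv x))" "integrable ?M (\<lambda>x. \<alpha> x * b (u\<^sub>r x) * (gr x \<bullet> gv x))"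
      by (rule ix; (rule sq)?; measurable)+
    then show "integrable ?M X" "(LINT x|?M. X x) = 0"
      using orth unfolding X_def by (simp_all add: gu_def gr_def gv_def v_def[abs_def])
  qed
  have pt: "AE x in ?M. \<alpha>\<^sub>0 * b\<^sub>0 * (norm (ge x))\<^sup>2 \<le>
      X x + (\<alpha>\<^sub>1 * B * (norm (ge x) * norm (gd x)) + \<alpha>\<^sub>1 * L * (p x * norm (ge x) + p x * norm (gd x)))"
    using \<alpha>(2) ae_e ae_v
  proof eventually_elim
    case (elim x)
    have \<alpha>x: "0 \<le> \<alpha> x" "\<alpha>\<^sub>0 \<le> \<alpha> x" "\<alpha> x \<le> \<alpha>\<^sub>1" using elim \<alpha>(3) by auto
    have bx: "0 \<le> b (u\<^sub>r x)" "b\<^sub>0 \<le> b (u\<^sub>r x)" "b (u\<^sub>r x) \<le> B" using b(2) b(3)[of "u\<^sub>r x"] b(4)[of "u\<^sub>r x"] by linarith+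
    have gr: "gr x = gu x - ge x" using elim by simp
    \<comment> \<open>Substitute gr = gu - ge and gv = ge - gd in \<open>X\<close>: freezing the
      coefficient at \<open>b (u\<^sub>r x)\<close> leaves the quadratic term, a mixed term and the
      defect of the nonlinearity.\<close>
    have eq: "\<alpha> x * b (u\<^sub>r x) * (norm (ge x))\<^sup>2 =
      X x + \<alpha> x * b (u\<^sub>r x) * (ge x \<bullet> gd x) + \<alpha> x * (b (u\<^sub>r x) - b (u x)) * (gu x \<bullet> gv x)"
      unfolding X_def gr elim(3) power2_norm_eq_inner by (simp add: inner_diff_left inner_diff_right algebra_simps)
    have 1: "\<alpha>\<^sub>0 * b\<^sub>0 * (norm (ge x))\<^sup>2 \<le> \<alpha> x * b (u\<^sub>r x) * (norm (ge x))\<^sup>2"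
      using \<alpha>x bx \<alpha>(3) b(2) by (intro mult_right_mono mult_mono) auto
    have 2: "\<alpha> x * b (u\<^sub>r x) * (ge x \<bullet> gd x) \<le> \<alpha>\<^sub>1 * B * (norm (ge x) * norm (gd x))"
    proof -
      have "\<alpha> x * b (u\<^sub>r x) * (ge x \<bullet> gd x) \<le> \<alpha> x * b (u\<^sub>r x) * (norm (ge x) * norm (gd x))"
        using \<alpha>x bx norm_cauchy_schwarz by (intro mult_left_mono) auto
      also have "\<dots> \<le> \<alpha>\<^sub>1 * B * (norm (ge x) * norm (gd x))"
        using \<alpha>x bx B0 by (intro mult_right_mono mult_mono) auto
      finally show ?thesis .
    qed
    have 3: "\<alpha> x * (b (u\<^sub>r x) - b (u x)) * (gu x \<bullet> gv x) \<le> \<alpha>\<^sub>1 * L * (p x * norm (ge x) + p x * norm (gd x))"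
    proof -
      have "\<alpha> x * (b (u\<^sub>r x) - b (u x)) * (gu x \<bullet> gv x) \<le> \<bar>\<alpha> x * (b (u\<^sub>r x) - b (u x)) * (gu x \<bullet> gv x)\<bar>" by simp
      also have "\<dots> = (\<alpha> x * \<bar>b (u\<^sub>r x) - b (u x)\<bar>) * \<bar>gu x \<bullet> gv x\<bar>" using \<alpha>x by (simp add: abs_mult)
      also have "\<dots> \<le> (\<alpha>\<^sub>1 * (L * \<bar>e x\<bar>)) * (norm (gu x) * (norm (ge x) + norm (gd x)))"
      proof (intro mult_mono)
        show "\<bar>b (u\<^sub>r x) - b (u x)\<bar> \<le> L * \<bar>e x\<bar>" using L(1)[of "u\<^sub>r x" "u x"] by (simp add: e_def abs_minus_commute)
        have "\<bar>gu x \<bullet> gv x\<bar> \<le> norm (gu x) * norm (gv x)" by (rule Cauchy_Schwarz_ineq2)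
        also have "\<dots> \<le> norm (gu x) * (norm (ge x) + norm (gd x))"
          unfolding elim(3) by (intro mult_left_mono norm_triangle_ineq4) simp
        finally show "\<bar>gu x \<bullet> gv x\<bar> \<le> norm (gu x) * (norm (ge x) + norm (gd x))" .
      qed (use \<alpha>x L(2) in auto)
      also have "\<dots> = \<alpha>\<^sub>1 * L * (p x * norm (ge x) + p x * norm (gd x))" by (simp add: p_def algebra_simps)
      finally show ?thesis .
    qed
    show ?case using 1 2 3 eq by linarith
  qed
  have ir: "integrable ?M (\<lambda>x. \<alpha>\<^sub>1 * B * (norm (ge x) * norm (gd x)))"
      "integrable ?M (\<lambda>x. \<alpha>\<^sub>1 * L * (p x * norm (ge x) + p x * norm (gd x)))"
    using c1(1) c2(1) c3(1) by simp_all
  have "\<alpha>\<^sub>0 * b\<^sub>0 * E\<^sup>2 = (LINT x|?M. \<alpha>\<^sub>0 * b\<^sub>0 * (norm (ge x))\<^sup>2)" by (simp add: E2)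
  also have "\<dots> \<le> (LINT x|?M. X x + (\<alpha>\<^sub>1 * B * (norm (ge x) * norm (gd x)) + \<alpha>\<^sub>1 * L * (p x * norm (ge x) + p x * norm (gd x))))"
    by (rule integral_mono_AE[OF _ _ pt]) (use sq iX ir in auto)
  also have "\<dots> = \<alpha>\<^sub>1 * B * (LINT x|?M. norm (ge x) * norm (gd x))
      + \<alpha>\<^sub>1 * L * ((LINT x|?M. p x * norm (ge x)) + (LINT x|?M. p x * norm (gd x)))"
    using iX ir c1(1) c2(1) c3(1) by simp
  also have "\<dots> \<le> \<alpha>\<^sub>1 * B * (E * D) + \<alpha>\<^sub>1 * L * (P * E + P * D)"
    using \<alpha>(3,4) B0 L(2) c1(2) c2(2) c3(2) by (intro add_mono mult_left_mono) auto
  also have "\<dots> = \<alpha>\<^sub>1 * B * (E * D) + \<alpha>\<^sub>1 * L * (P * (E + D))" by (simp add: distrib_left)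
  also have "\<dots> \<le> \<alpha>\<^sub>1 * B * (E * D) + \<alpha>\<^sub>1 * L * (\<kappa> * \<delta> * E * (E + D))"
    using \<alpha>(3,4) L(2) P E0 D0 by (intro add_left_mono mult_left_mono mult_right_mono) auto
  finally show ?thesis .
qed


section \<open>Linear structure of the discrete spaces\<close>

lemma finite_element_space_diff:
  assumes V: "finite_element_space \<Omega> T V" and v: "v \<in> V" and w: "w \<in> V"
  shows "(\<lambda>x. v x - w x) \<in> V"
proof -
  obtain B where B: "V = {\<lambda>x. \<Sum>\<phi>\<in>B. c \<phi> * \<phi> x | c. True}"
    using V unfolding finite_element_space_def by blast
  obtain c c' where "v = (\<lambda>x. \<Sum>\<phi>\<in>B. c \<phi> * \<phi> x)" "w = (\<lambda>x. \<Sum>\<phi>\<in>B. c' \<phi> * \<phi> x)"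
    using v w unfolding B by blast
  then have "(\<lambda>x. v x - w x) = (\<lambda>x. \<Sum>\<phi>\<in>B. (c \<phi> - c' \<phi>) * \<phi> x)"
    by (simp add: left_diff_distrib sum_subtractf)
  then show ?thesis unfolding B by (intro CollectI exI[of _ "\<lambda>\<phi>. c \<phi> - c' \<phi>"]) simp
qed

lemma bubble_space_diff:
  assumes \<Omega>: "open \<Omega>" and T: "\<And>K. K \<in> T \<Longrightarrow> open K"
    and v: "v \<in> bubble_space \<Omega> T" and w: "w \<in> bubble_space \<Omega> T"
  shows "(\<lambda>x. v x - w x) \<in> bubble_space \<Omega> T"
  using assms unfolding bubble_space_def by (auto intro: H10_diff)

text \<open>These two facts make \<open>w\<^sub>r - u\<^sub>r\<close> admissible in both equations:
  in the discrete one because it stays in \<open>V\<^sub>r\<close>, in the continuous one because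
  \<open>V\<^sub>r\<close> is conforming. Differences are regrouped summand by summand.\<close>

lemma residual_free_bubble_space:
  assumes \<Omega>: "open \<Omega>" and T: "partition_with_mesh_size \<Omega> h T"
    and Vh: "finite_element_space \<Omega> T V\<^sub>h" and Vr: "is_direct_sum \<Omega> V\<^sub>r V\<^sub>h (bubble_space \<Omega> T)"
  shows "V\<^sub>r \<subseteq> H10 \<Omega>" "v \<in> V\<^sub>r \<Longrightarrow> w \<in> V\<^sub>r \<Longrightarrow> (\<lambda>x. v x - w x) \<in> V\<^sub>r"
proof -
  have V: "V\<^sub>r = {\<lambda>x. v x + w x | v w. v \<in> V\<^sub>h \<and> w \<in> bubble_space \<Omega> T}"
    using Vr by (simp add: is_direct_sum_def)
  have "V\<^sub>h \<subseteq> H10 \<Omega>" "bubble_space \<Omega> T \<subseteq> H10 \<Omega>"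
    using Vh by (auto simp: finite_element_space_def bubble_space_def)
  then show "V\<^sub>r \<subseteq> H10 \<Omega>" unfolding V using H10_add[OF \<Omega>] by blast
  have op: "open K" if "K \<in> T" for K
    using T that by (auto simp: partition_with_mesh_size_def polygonal_domain_def)
  assume "v \<in> V\<^sub>r" "w \<in> V\<^sub>r"
  then obtain v1 v2 w1 w2 where vw: "v = (\<lambda>x. v1 x + v2 x)" "w = (\<lambda>x. w1 x + w2 x)"
    "v1 \<in> V\<^sub>h" "w1 \<in> V\<^sub>h" "v2 \<in> bubble_space \<Omega> T" "w2 \<in> bubble_space \<Omega> T"
    unfolding V by blast
  have "(\<lambda>x. v x - w x) = (\<lambda>x. (v1 x - w1 x) + (v2 x - w2 x))" unfolding vw by (simp add: algebra_simps)
  moreover have "(\<lambda>x. v1 x - w1 x) \<in> V\<^sub>h" by (rule finite_element_space_diff[OF Vh vw(3,4)])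
  moreover have "(\<lambda>x. v2 x - w2 x) \<in> bubble_space \<Omega> T"
    by (rule bubble_space_diff[OF \<Omega> _ vw(5,6)]) (rule op)
  ultimately show "(\<lambda>x. v x - w x) \<in> V\<^sub>r"
    unfolding V mem_Collect_eq
    by - (rule exI[of _ "\<lambda>x. v1 x - w1 x"], rule exI[of _ "\<lambda>x. v2 x - w2 x"], blast)
qed

theorem proposition4p2:
  fixes \<Omega> :: "(real^2) set" and \<alpha>\<^sub>0 \<alpha>\<^sub>1 b\<^sub>0 :: real and b :: "real \<Rightarrow> real"
  assumes "polygonal_domain \<Omega>" and "bounded \<Omega>"
    and "0 < \<alpha>\<^sub>0" and "\<alpha>\<^sub>0 \<le> \<alpha>\<^sub>1" and "0 < b\<^sub>0"
    and "continuous_on UNIV b" and "b \<in> sobolev 2 \<infinity> UNIV" and "\<And>t. b\<^sub>0 \<le> b t"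
  shows "\<exists>\<delta>>0. \<exists>C>0.
    \<forall>(\<alpha> :: real^2 \<Rightarrow> real) (f :: real^2 \<Rightarrow> real) (h :: real) (T :: (real^2) set set)
     (V\<^sub>h :: (real^2 \<Rightarrow> real) set) (V\<^sub>r :: (real^2 \<Rightarrow> real) set)
     (u :: real^2 \<Rightarrow> real) (u\<^sub>r :: real^2 \<Rightarrow> real).
      \<alpha> \<in> borel_measurable (lebesgue_on \<Omega>) \<and>
      (AE x in lebesgue_on \<Omega>. \<alpha>\<^sub>0 \<le> \<alpha> x \<and> \<alpha> x \<le> \<alpha>\<^sub>1) \<and>
      f \<in> Lp_space 2 \<Omega> \<and>
      partition_with_mesh_size \<Omega> h T \<and>
      finite_element_space \<Omega> T V\<^sub>h \<and>
      is_direct_sum \<Omega> V\<^sub>r V\<^sub>h (bubble_space \<Omega> T) \<and>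
      u \<in> H10 \<Omega> \<and>
      (\<forall>v\<in>H10 \<Omega>.
         (LINT x|lebesgue_on \<Omega>. \<alpha> x * b (u x) * (weak_grad \<Omega> u x \<bullet> weak_grad \<Omega> v x))
           = (LINT x|lebesgue_on \<Omega>. f x * v x)) \<and>
      u\<^sub>r \<in> V\<^sub>r \<and>
      (\<forall>v\<^sub>r\<in>V\<^sub>r.
         (LINT x|lebesgue_on \<Omega>. \<alpha> x * b (u\<^sub>r x) * (weak_grad \<Omega> u\<^sub>r x \<bullet> weak_grad \<Omega> v\<^sub>r x))
           = (LINT x|lebesgue_on \<Omega>. f x * v\<^sub>r x)) \<and>
      u \<in> sobolev 1 6 \<Omega> \<and> W1p_norm 6 \<Omega> u \<le> \<delta>
      \<longrightarrow> (\<forall>w\<^sub>r\<in>V\<^sub>r. Lp_norm 2 \<Omega> (weak_grad \<Omega> (\<lambda>x. u x - u\<^sub>r x))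
                       \<le> C * Lp_norm 2 \<Omega> (weak_grad \<Omega> (\<lambda>x. u x - w\<^sub>r x)))"
proof -
  define m where "m = measure lborel \<Omega>"
  have \<Omega>: "open \<Omega>" using assms(1) by (simp add: polygonal_domain_def)
  obtain B L\<^sub>0 where B: "\<And>t. \<bar>b t\<bar> \<le> B" and L\<^sub>0: "\<And>s t. \<bar>b s - b t\<bar> \<le> L\<^sub>0 * \<bar>s - t\<bar>"
    using sobolev_2_infinity_bounded_Lipschitz[OF assms(6,7)] by blast
  \<comment> \<open>Made strictly positive because \<delta> is defined by a division by it.\<close>
  define L where "L = \<bar>L\<^sub>0\<bar> + 1"
  have L: "\<bar>b s - b t\<bar> \<le> L * \<bar>s - t\<bar>" for s t
    by (rule order_trans[OF L\<^sub>0 mult_right_mono]) (auto simp: L_def)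
  have L0: "0 < L" by (simp add: L_def)
  have B0: "0 < B" using B[of 0] assms(5) assms(8)[of 0] by linarith
  have \<alpha>0: "0 < \<alpha>\<^sub>1" using assms(3,4) by linarith
  define \<kappa> where "\<kappa> = 64 * m * (m + 1) + 1"
  have \<kappa>: "0 < \<kappa>" by (simp add: \<kappa>_def m_def add_nonneg_pos)
  define c where "c = \<alpha>\<^sub>0 * b\<^sub>0"
  have c: "0 < c" using assms(3,5) by (simp add: c_def)
  \<comment> \<open>Chosen so that the term in \<delta> contributes exactly half of the coercivity
    constant \<open>c\<close>, which is then absorbed on the left.\<close>
  define \<delta> where "\<delta> = c / (2 * \<alpha>\<^sub>1 * L * \<kappa>)"
  have \<delta>: "0 < \<delta>" using c \<alpha>0 L0 \<kappa> by (simp add: \<delta>_def)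
  have \<delta>c: "\<alpha>\<^sub>1 * L * \<kappa> * \<delta> = c / 2" using \<alpha>0 L0 \<kappa> by (simp add: \<delta>_def field_simps)
  \<comment> \<open>After absorption the coefficient of \<open>E * D\<close> is \<alpha>_1 B + c /
    2; dividing by the remaining c / 2 gives this value.\<close>
  define C where "C = 2 * \<alpha>\<^sub>1 * B / c + 1"
  have C: "0 < C" using \<alpha>0 B0 c by (simp add: C_def add_pos_pos)
  show ?thesis
  proof (rule exI[of _ \<delta>], rule conjI[OF \<delta>], rule exI[of _ C], rule conjI[OF C], intro allI impI ballI, elim conjE)
    fix \<alpha> f :: "real^2 \<Rightarrow> real" and h :: real and T :: "(real^2) set set"
      and V\<^sub>h V\<^sub>r :: "(real^2 \<Rightarrow> real) set" and u u\<^sub>r w :: "real^2 \<Rightarrow> real"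
    assume \<alpha>: "\<alpha> \<in> borel_measurable (lebesgue_on \<Omega>)"
        "AE x in lebesgue_on \<Omega>. \<alpha>\<^sub>0 \<le> \<alpha> x \<and> \<alpha> x \<le> \<alpha>\<^sub>1"
      and T: "partition_with_mesh_size \<Omega> h T" and Vh: "finite_element_space \<Omega> T V\<^sub>h"
      and Vr: "is_direct_sum \<Omega> V\<^sub>r V\<^sub>h (bubble_space \<Omega> T)"
      and u: "u \<in> H10 \<Omega>"
      and weak: "\<forall>v\<in>H10 \<Omega>. (LINT x|lebesgue_on \<Omega>. \<alpha> x * b (u x) * (weak_grad \<Omega> u x \<bullet> weak_grad \<Omega> v x))
           = (LINT x|lebesgue_on \<Omega>. f x * v x)"
      and ur: "u\<^sub>r \<in> V\<^sub>r"
      and discrete: "\<forall>v\<^sub>r\<in>V\<^sub>r. (LINT x|lebesgue_on \<Omega>. \<alpha> x * b (u\<^sub>r x) * (weak_grad \<Omega> u\<^sub>r x \<bullet> weak_grad \<Omega> v\<^sub>r x))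
           = (LINT x|lebesgue_on \<Omega>. f x * v\<^sub>r x)"
      and u6: "u \<in> sobolev 1 6 \<Omega>" "W1p_norm 6 \<Omega> u \<le> \<delta>"
      and w: "w \<in> V\<^sub>r"
    note V = residual_free_bubble_space[OF \<Omega> T Vh Vr]
    define E where "E = Lp_norm 2 \<Omega> (weak_grad \<Omega> (\<lambda>x. u x - u\<^sub>r x))"
    define D where "D = Lp_norm 2 \<Omega> (weak_grad \<Omega> (\<lambda>x. u x - w x))"
    have nonneg: "0 \<le> E" "0 \<le> D" by (simp_all add: E_def D_def Lp_norm_def)
    have wu: "(\<lambda>x. w x - u\<^sub>r x) \<in> V\<^sub>r" by (rule V(2)[OF w ur])
    have orth: "(LINT x|lebesgue_on \<Omega>. \<alpha> x * b (u x) * (weak_grad \<Omega> u x \<bullet> weak_grad \<Omega> (\<lambda>x. w x - u\<^sub>r x) x))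
      = (LINT x|lebesgue_on \<Omega>. \<alpha> x * b (u\<^sub>r x) * (weak_grad \<Omega> u\<^sub>r x \<bullet> weak_grad \<Omega> (\<lambda>x. w x - u\<^sub>r x) x))"
      using bspec[OF weak subsetD[OF V(1) wu]] bspec[OF discrete wu] by simp
    have "c * E\<^sup>2 \<le> \<alpha>\<^sub>1 * B * (E * D) + \<alpha>\<^sub>1 * L * (\<kappa> * \<delta> * E * (E + D))"
      unfolding c_def E_def D_def \<kappa>_def m_def
      by (rule Galerkin_energy_estimate[OF \<Omega> assms(2) \<alpha> assms(3,4,6,5,8) B L less_imp_le[OF L0] u
            subsetD[OF V(1) ur] subsetD[OF V(1) w] orth W16_weak_grad_power4[OF \<Omega> assms(2) u6 \<delta>] \<delta>])
    also have "\<alpha>\<^sub>1 * L * (\<kappa> * \<delta> * E * (E + D)) = (\<alpha>\<^sub>1 * L * \<kappa> * \<delta>) * (E * (E + D))" by (simp add: mult_ac)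
    also have "\<dots> = c / 2 * E\<^sup>2 + c / 2 * (E * D)" unfolding \<delta>c by (simp add: algebra_simps power2_eq_square)
    finally have "c / 2 * E\<^sup>2 \<le> (\<alpha>\<^sub>1 * B + c / 2) * (E * D)" by (simp add: algebra_simps)
    also have "\<dots> = c / 2 * (C * D * E)" using c by (simp add: C_def field_simps)
    finally have "E\<^sup>2 \<le> C * D * E" using c by simp
    \<comment> \<open>One factor \<open>E\<close> is cancelled; if it is 0 the claim is only that
      the right-hand side is nonnegative.\<close>
    then have "E \<le> C * D" using nonneg C by (cases "E = 0") (auto simp: power2_eq_square)
    then show "Lp_norm 2 \<Omega> (weak_grad \<Omega> (\<lambda>x. u x - u\<^sub>r x)) \<le> C * Lp_norm 2 \<Omega> (weak_grad \<Omega> (\<lambda>x. u x - w x))"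
      by (simp add: E_def D_def)
  qed
qed

end
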